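(* A ring $A$ is a Noetherian SSP-ring if and only if $A$ is a ZPI-ring.
   Context: All rings are commutative with $1$. An ideal $I$ is radical if $\sqrt{I}=I$ (the whole ring counts as a radical ideal). An SSP-ring is a ring in which every ideal is a (finite) product of radical ideals. A ZPI-ring is a ring whose proper ideals are all (finite) products of prime ideals. *)

theory Defs
  imports "HOL-Algebra.Ring_Divisibility" "HOL-Algebra.Ideal_Product"
begin

definition radical :: "('a, 'b) ring_scheme \<Rightarrow> 'a set \<Rightarrow> 'a set"
  where "radical R I = {x \<in> carrier R. \<exists>n::nat. n \<ge> 1 \<and> x [^]\<^bsub>R\<^esub> n \<in> I}"

text \<open>There is no properness condition: the whole ring is a radical ideal.\<close>

definition radical_ideal :: "'a set \<Rightarrow> ('a, 'b) ring_scheme \<Rightarrow> bool"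
  where "radical_ideal I R \<longleftrightarrow> ideal I R \<and> radical R I = I"

text \<open>The empty product is the unit ideal. Hence a proper ideal is only ever the product of a
  nonempty list.\<close>

definition ideal_prod_list :: "('a, 'b) ring_scheme \<Rightarrow> 'a set list \<Rightarrow> 'a set"
  where "ideal_prod_list R Is = foldr (ideal_prod R) Is (carrier R)"

locale ssp_ring = cring +
  assumes ideal_radical_factorization:
    "ideal I R \<Longrightarrow> \<exists>Is. (\<forall>J \<in> set Is. radical_ideal J R) \<and> I = ideal_prod_list R Is"

locale zpi_ring = cring +
  assumes ideal_prime_factorization:
    "\<lbrakk> ideal I R; I \<noteq> carrier R \<rbrakk> \<Longrightarrow>
       \<exists>Ps. (\<forall>P \<in> set Ps. primeideal P R) \<and> I = ideal_prod_list R Ps"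

end

theory Submission
  imports Defs
begin

text \<open>A Noetherian SSP-ring is a ZPI-ring. Let \<open>M\<close> be a maximal ideal. An ideal between \<open>M\<^sup>2\<close> and \<open>M\<close> is a
product of radical ideals containing \<open>M\<close>, so it is \<open>M\<close> or \<open>M\<^sup>2\<close>
(\<open>no_ideal_between_square\<close>). By Nakayama's lemma \<open>M\<close> is principal after localization at \<open>M\<close>, and
every prime \<open>P\<close> properly below \<open>M\<close> satisfies \<open>P = M P\<close> locally, hence vanishes locally. It follows that
incomparable primes are comaximal. In a Noetherian ring a radical ideal is a finite intersection of
primes; keeping the minimal ones, the intersection is comaximal and so equals the product. Factoring an
ideal into radical ideals and each of these into primes gives the ZPI property.

Conversely, a ZPI-ring is an SSP-ring because primes are radical, so the same statement about \<open>M\<^sup>2\<close>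
holds. As products of finitely generated ideals are finitely generated, it is enough to generate
each prime by finitely many elements. The main point is that \<open>M\<close> is never idempotent modulo a prime
\<open>Q\<close> properly below it (\<open>not_idempotent_modulo_prime\<close>). This is a variant of
the classical argument that invertible primes in a domain with prime factorization are maximal,
carried out modulo \<open>Q\<close> and locally at \<open>M\<close>. It shows that \<open>M\<close> divides a principal ideal \<open>(p)\<close> with a cofactor
not contained in \<open>M\<close> (\<open>maximal_divides_principal\<close>), so \<open>M\<close> is generated by two elements and is locally
principal. Consequently a prime properly below \<open>M\<close> vanishes locally, with one denominator for all its
elements (\<open>smaller_prime_locally_zero\<close>), and a nonmaximal prime is then
generated by a single element by a partition of unity with its annihilator.

Localization is expressed inside the ring: the relation \<open>locally_sub R M I J\<close> asks for a
denominator \<open>u \<notin> M\<close> with \<open>u I \<subseteq> J\<close>.\<close>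

(* Otherwise sums of ideals are ambiguous with disjoint unions of sets. *)
no_notation Sum_Type.Plus (infixr "<+>" 65)

section \<open>Sums and products of ideals\<close>

lemma (in ring) ideal_a_closed: "ideal I R \<Longrightarrow> a \<in> I \<Longrightarrow> b \<in> I \<Longrightarrow> a \<oplus> b \<in> I"
  by (simp add: additive_subgroup.a_closed ideal.axioms(1))

lemma (in ring) ideal_zero_closed: "ideal I R \<Longrightarrow> \<zero> \<in> I"
  by (simp add: additive_subgroup.zero_closed ideal.axioms(1))

lemma (in ring) ideal_minus_closed:
  assumes "ideal I R" "a \<in> I" "b \<in> I" shows "a \<ominus> b \<in> I"
  by (metis a_minus_def additive_subgroup.a_inv_closed assms ideal.axioms(1) ideal_a_closed)

lemma (in ring) ideal_subset_carrier: "ideal I R \<Longrightarrow> I \<subseteq> carrier R"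
  by (simp add: additive_subgroup.a_subset ideal.axioms(1))

lemma (in ring) set_addI: "a \<in> I \<Longrightarrow> b \<in> J \<Longrightarrow> a \<oplus> b \<in> I <+> J"
  unfolding set_add_def' by blast

lemma (in ring) set_addE:
  assumes "x \<in> I <+> J" obtains a b where "a \<in> I" "b \<in> J" "x = a \<oplus> b"
  using assms unfolding set_add_def' by blast

lemma (in ring) set_add_mono: "I \<subseteq> I' \<Longrightarrow> J \<subseteq> J' \<Longrightarrow> I <+> J \<subseteq> I' <+> J'"
  unfolding set_add_def' by blast

lemma (in ring) subset_set_add:
  assumes "ideal I R" "ideal J R"
  shows "I \<subseteq> I <+> J" "J \<subseteq> I <+> J"
  using assms union_genideal[of I J] genideal_self[of "I \<union> J"]
  by (auto dest: ideal_subset_carrier)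

lemma (in ring) set_add_least:
  assumes "ideal K R" "I \<subseteq> K" "J \<subseteq> K" shows "I <+> J \<subseteq> K"
  using assms by (auto elim!: set_addE intro: ideal_a_closed)

lemma (in ring) ideal_prod_mono: "I \<subseteq> I' \<Longrightarrow> J \<subseteq> J' \<Longrightarrow> I \<cdot> J \<subseteq> I' \<cdot> J'"
proof
  fix x assume s: "I \<subseteq> I'" "J \<subseteq> J'" and x: "x \<in> I \<cdot> J"
  from x show "x \<in> I' \<cdot> J'"
    by (induct x rule: ideal_prod.induct) (use s in \<open>auto intro: ideal_prod.prod ideal_prod.sum\<close>)
qed

lemma (in ring) ideal_prod_least:
  assumes "ideal K R" "\<And>i j. i \<in> I \<Longrightarrow> j \<in> J \<Longrightarrow> i \<otimes> j \<in> K"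
  shows "I \<cdot> J \<subseteq> K"
proof
  fix x assume "x \<in> I \<cdot> J"
  then show "x \<in> K"
    by (induct x rule: ideal_prod.induct) (auto intro: assms ideal_a_closed)
qed

lemma (in cring) ideal_colon:
  "ideal K R \<Longrightarrow> a \<in> carrier R \<Longrightarrow> ideal {x \<in> carrier R. a \<otimes> x \<in> K} R"
  by (rule ideal.helper_max_prime[OF _ is_cring])

text \<open>As \<open>(K : a)\<close> is an ideal, testing the generators of the product is enough.\<close>

lemma (in cring) mult_ideal_prod_in:
  assumes "ideal K R" "ideal I R" "ideal J R" "a \<in> carrier R"
    and "\<And>i j. i \<in> I \<Longrightarrow> j \<in> J \<Longrightarrow> a \<otimes> (i \<otimes> j) \<in> K" and "x \<in> I \<cdot> J"
  shows "a \<otimes> x \<in> K"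
proof -
  have "I \<cdot> J \<subseteq> {x \<in> carrier R. a \<otimes> x \<in> K}"
    using assms by (intro ideal_prod_least ideal_colon) (auto intro: ideal.Icarr)
  then show ?thesis using assms by blast
qed

lemma (in cring) PIdl_memE:
  assumes "x \<in> PIdl a" obtains r where "r \<in> carrier R" "x = r \<otimes> a"
  using assms unfolding cgenideal_def by blast

lemma (in cring) ideal_prod_PIdlE:
  assumes "ideal K R" "a \<in> carrier R" "x \<in> K \<cdot> (PIdl a)"
  obtains k where "k \<in> K" "x = k \<otimes> a"
proof -
  have "\<exists>k\<in>K. x = k \<otimes> a"
    using assms(3)
  proof (induct x rule: ideal_prod.induct)
    case (prod i j)
    then obtain r where r: "r \<in> carrier R" "j = r \<otimes> a" by (auto elim: PIdl_memE)
    have "i \<otimes> j = (i \<otimes> r) \<otimes> a" using r prod assms by (simp add: m_assoc ideal.Icarr)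
    then show ?case using ideal.I_r_closed[OF assms(1)] prod r by blast
  next
    case (sum s1 s2)
    then obtain k1 k2 where k: "k1 \<in> K" "s1 = k1 \<otimes> a" "k2 \<in> K" "s2 = k2 \<otimes> a" by blast
    then have "s1 \<oplus> s2 = (k1 \<oplus> k2) \<otimes> a"
      using assms by (simp add: l_distr ideal.Icarr)
    then show ?case using k ideal_a_closed[OF assms(1)] by blast
  qed
  then show ?thesis using that by blast
qed

lemma (in cring) minus_mult_eq:
  assumes "a \<in> carrier R" "b \<in> carrier R" "x \<in> carrier R" "q \<in> carrier R" "a \<otimes> x = b \<otimes> x \<oplus> q"
  shows "(a \<ominus> b) \<otimes> x = q"
proof -
  have "(a \<ominus> b) \<otimes> x = a \<otimes> x \<ominus> b \<otimes> x"
    using assms by (simp add: a_minus_def l_distr l_minus)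
  also have "\<dots> = q"
    using assms by (simp add: a_minus_def a_assoc r_neg a_comm[of _ "\<ominus> (b \<otimes> x)"] r_neg1)
  finally show ?thesis .
qed

text \<open>In the domain \<open>R/Q\<close> an equation \<open>g y = k y\<close> with \<open>y \<noteq> 0\<close> gives \<open>g = k\<close>. This is how a
containment of ideals multiplied by \<open>y\<close> is turned into a statement free of \<open>y\<close>.\<close>

lemma (in cring) cancel_modulo_prime:
  assumes Q: "primeideal Q R" and K: "ideal K R"
    and y: "y \<in> carrier R" "y \<notin> Q" and g: "g \<in> carrier R"
    and gy: "g \<otimes> y \<in> K \<cdot> (PIdl y) <+> Q"
  shows "g \<in> K <+> Q"
proof -
  have Qi: "ideal Q R" by (rule primeideal.axioms(1)[OF Q])
  obtain k q where kq: "k \<in> K" "q \<in> Q" "g \<otimes> y = k \<otimes> y \<oplus> q"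
    using gy by (metis set_addE ideal_prod_PIdlE[OF K y(1)])
  have c: "k \<in> carrier R" "q \<in> carrier R" using kq K Qi by (auto intro: ideal.Icarr)
  have "(g \<ominus> k) \<otimes> y = q" using minus_mult_eq kq c g y by blast
  then have "g \<ominus> k \<in> Q"
    using primeideal.I_prime[OF Q, of "g \<ominus> k" y] kq y c g by auto
  then have "k \<oplus> (g \<ominus> k) \<in> K <+> Q" using kq set_addI by blast
  moreover have "k \<oplus> (g \<ominus> k) = g"
    using c g by (simp add: a_minus_def a_lcomm r_neg)
  ultimately show ?thesis by simp
qed

section \<open>Products of lists of ideals\<close>

lemma ideal_prod_list_Nil [simp]: "ideal_prod_list R [] = carrier R"
  and ideal_prod_list_Cons [simp]: "ideal_prod_list R (I # Is) = I \<cdot>\<^bsub>R\<^esub> ideal_prod_list R Is"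
  by (simp_all add: ideal_prod_list_def)

lemma (in cring) ideal_prod_list_ideal:
  "\<forall>I\<in>set Is. ideal I R \<Longrightarrow> ideal (ideal_prod_list R Is) R"
  by (induct Is) (auto intro: oneideal ideal_prod_is_ideal)

lemma (in cring) ideal_prod_list_append:
  "\<forall>I\<in>set Is \<union> set Js. ideal I R \<Longrightarrow>
    ideal_prod_list R (Is @ Js) = ideal_prod_list R Is \<cdot> ideal_prod_list R Js"
proof (induct Is)
  case Nil
  then show ?case
    using ideal_prod_commute[OF oneideal] ideal_prod_list_ideal[of Js] ideal_prod_one by simp
qed (simp add: ideal_prod_assoc ideal_prod_list_ideal)

lemma (in cring) ideal_prod_list_remove1:
  "\<forall>I\<in>set Is. ideal I R \<Longrightarrow> J \<in> set Is \<Longrightarrow>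
    ideal_prod_list R Is = J \<cdot> ideal_prod_list R (remove1 J Is)"
proof (induct Is)
  case (Cons I Is)
  let ?B = "ideal_prod_list R (remove1 J Is)"
  show ?case
  proof (cases "I = J")
    case False
    have i: "ideal I R" "ideal J R" "ideal ?B R"
      using Cons.prems by (auto intro!: ideal_prod_list_ideal dest: notin_set_remove1)
    have "ideal_prod_list R (I # Is) = I \<cdot> (J \<cdot> ?B)" using Cons False by simp
    also have "\<dots> = J \<cdot> (I \<cdot> ?B)"
      using i by (metis ideal_prod_assoc ideal_prod_commute)
    finally show ?thesis using False by simp
  qed simp
qed simp

lemma (in cring) ideal_prod_list_subset:
  assumes "\<forall>I\<in>set Is. ideal I R" "J \<in> set Is" shows "ideal_prod_list R Is \<subseteq> J"
proof -
  have "ideal (ideal_prod_list R (remove1 J Is)) R"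
    using assms(1) by (auto intro!: ideal_prod_list_ideal dest: notin_set_remove1)
  then show ?thesis
    using ideal_prod_list_remove1[OF assms] ideal_prod_inter assms by blast
qed

lemma (in cring) prime_contains_factor:
  "primeideal P R \<Longrightarrow> \<forall>I\<in>set Is. ideal I R \<Longrightarrow> ideal_prod_list R Is \<subseteq> P \<Longrightarrow> \<exists>I\<in>set Is. I \<subseteq> P"
proof (induct Is)
  case Nil
  then show ?case
    using ideal_subset_carrier[OF primeideal.axioms(1)] primeideal.I_notcarr by fastforce
next
  case (Cons I Is)
  then show ?case
    using primeideal_divides_ideal_prod[of P I "ideal_prod_list R Is"] ideal_prod_list_ideal by auto
qed

section \<open>Maximal ideals\<close>

lemma (in cring) exists_maximalideal:
  assumes "ideal I R" "I \<noteq> carrier R"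
  obtains M where "maximalideal M R" "I \<subseteq> M"
proof -
  define \<A> where "\<A> = {J. ideal J R \<and> I \<subseteq> J \<and> \<one> \<notin> J}"
  have "\<exists>M\<in>\<A>. \<forall>X\<in>\<A>. M \<subseteq> X \<longrightarrow> X = M"
  proof (rule subset_Zorn_nonempty)
    show "\<A> \<noteq> {}"
      using assms ideal.one_imp_carrier unfolding \<A>_def by blast
  next
    fix C assume C: "C \<noteq> {}" "subset.chain \<A> C"
    then have sub: "C \<subseteq> \<A>" by (simp add: pred_on.chain_def)
    have "subset.chain {J. ideal J R} C"
      using C unfolding pred_on.chain_def \<A>_def by blast
    then have "ideal (\<Union>C) R" using chain_Union_is_ideal[of C] C(1) by simp
    then show "\<Union>C \<in> \<A>" using sub C(1) unfolding \<A>_def by blast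
  qed
  then obtain M where M: "ideal M R" "I \<subseteq> M" "\<one> \<notin> M"
    and max: "\<And>J. ideal J R \<Longrightarrow> I \<subseteq> J \<Longrightarrow> \<one> \<notin> J \<Longrightarrow> M \<subseteq> J \<Longrightarrow> J = M"
    unfolding \<A>_def by auto
  have "maximalideal M R"
  proof (rule maximalidealI)
    show "carrier R \<noteq> M" using M by blast
    show "J = M \<or> J = carrier R" if "ideal J R" "M \<subseteq> J" "J \<subseteq> carrier R" for J
      using that max[of J] M ideal.one_imp_carrier by blast
  qed (fact M)
  then show thesis using that M by blast
qed

lemma (in cring) maximal_sum_eq_carrier:
  assumes M: "maximalideal M R" and I: "ideal I R" "\<not> I \<subseteq> M"
  shows "M <+> I = carrier R"
proof -
  have Mi: "ideal M R" by (rule maximalideal.axioms(1)[OF M])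
  have "ideal (M <+> I) R" using Mi I by (simp add: add_ideals)
  then show ?thesis
    using maximalideal.I_maximal[OF M, of "M <+> I"] subset_set_add[OF Mi I(1)] I(2)
      ideal_subset_carrier by blast
qed

lemma (in cring) carrier_eq_sumE:
  assumes "I <+> J = carrier R"
  obtains a b where "a \<in> I" "b \<in> J" "\<one> = a \<oplus> b"
  using assms one_closed by (metis set_addE)

section \<open>Containment after localization\<close>

text \<open>For a prime \<open>M\<close> this says \<open>I\<^sub>M \<subseteq> J\<^sub>M\<close> in the strong form that one denominator serves for all
elements of \<open>I\<close>. For finitely generated \<open>I\<close> the two agree; the uniform version lets arguments in
the local ring \<open>R\<^sub>M\<close> be carried out inside \<open>R\<close>.\<close>

definition locally_sub :: "('a, 'b) ring_scheme \<Rightarrow> 'a set \<Rightarrow> 'a set \<Rightarrow> 'a set \<Rightarrow> bool"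
  where "locally_sub R M I J \<longleftrightarrow> (\<exists>u\<in>carrier R - M. \<forall>x\<in>I. u \<otimes>\<^bsub>R\<^esub> x \<in> J)"

context cring
begin

lemma prime_one_notin: "primeideal M R \<Longrightarrow> \<one> \<notin> M"
  using ideal.one_imp_carrier primeideal.I_notcarr primeideal.axioms(1) by metis

lemma locally_sub_subset:
  assumes "primeideal M R" "I \<subseteq> J" "J \<subseteq> carrier R" shows "locally_sub R M I J"
  unfolding locally_sub_def using assms prime_one_notin
  by (intro bexI[of _ \<one>]) (auto simp: subset_iff)

lemma locally_sub_trans:
  assumes M: "primeideal M R" and IJ: "locally_sub R M I J" and JK: "locally_sub R M J K"
    and I: "I \<subseteq> carrier R"
  shows "locally_sub R M I K"
proof -
  obtain u where u: "u \<in> carrier R" "u \<notin> M" "\<And>x. x \<in> I \<Longrightarrow> u \<otimes> x \<in> J"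
    using IJ unfolding locally_sub_def by blast
  obtain v where v: "v \<in> carrier R" "v \<notin> M" "\<And>x. x \<in> J \<Longrightarrow> v \<otimes> x \<in> K"
    using JK unfolding locally_sub_def by blast
  have "v \<otimes> u \<in> carrier R - M"
    using u v primeideal.I_prime[OF M, of v u] by auto
  moreover have "(v \<otimes> u) \<otimes> x \<in> K" if "x \<in> I" for x
    using u v that I by (simp add: m_assoc subset_iff)
  ultimately show ?thesis unfolding locally_sub_def by blast
qed

lemma locally_sub_mono:
  assumes "locally_sub R M I J" "I' \<subseteq> I" "J \<subseteq> J'" shows "locally_sub R M I' J'"
  using assms unfolding locally_sub_def by blast

lemma locally_sub_prod:
  assumes IJ: "locally_sub R M I J" and i: "ideal L R" "ideal I R" "ideal J R"
  shows "locally_sub R M (L \<cdot> I) (L \<cdot> J)"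
proof -
  obtain u where u: "u \<in> carrier R" "u \<notin> M" "\<And>x. x \<in> I \<Longrightarrow> u \<otimes> x \<in> J"
    using IJ unfolding locally_sub_def by blast
  have "u \<otimes> x \<in> L \<cdot> J" if "x \<in> L \<cdot> I" for x
  proof (rule mult_ideal_prod_in[OF _ _ _ _ _ that])
    fix l a assume la: "l \<in> L" "a \<in> I"
    then have "u \<otimes> (l \<otimes> a) = l \<otimes> (u \<otimes> a)"
      using u i by (simp add: m_lcomm ideal.Icarr)
    then show "u \<otimes> (l \<otimes> a) \<in> L \<cdot> J" using la u by (simp add: ideal_prod.prod)
  qed (use i u in \<open>auto intro: ideal_prod_is_ideal\<close>)
  then show ?thesis using u unfolding locally_sub_def by blast
qed

lemma locally_sub_add:
  assumes IJ: "locally_sub R M I J" and i: "ideal K R" "ideal I R" "ideal J R"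
  shows "locally_sub R M (I <+> K) (J <+> K)"
proof -
  obtain u where u: "u \<in> carrier R" "u \<notin> M" "\<And>x. x \<in> I \<Longrightarrow> u \<otimes> x \<in> J"
    using IJ unfolding locally_sub_def by blast
  have "u \<otimes> x \<in> J <+> K" if x: "x \<in> I <+> K" for x
  proof -
    obtain a k where "a \<in> I" "k \<in> K" "x = a \<oplus> k" using x by (rule set_addE)
    then show ?thesis using u i
      by (simp add: r_distr ideal.Icarr set_addI ideal.I_l_closed)
  qed
  then show ?thesis using u unfolding locally_sub_def by blast
qed

text \<open>A prime \<open>P \<subseteq> M\<close> is its own preimage under localization at \<open>M\<close>.\<close>

lemma locally_sub_prime:
  assumes P: "primeideal P R" and PM: "P \<subseteq> M" and IP: "locally_sub R M I P" and I: "I \<subseteq> carrier R"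
  shows "I \<subseteq> P"
  using assms primeideal.I_prime[OF P] unfolding locally_sub_def by blast

end

section \<open>Nakayama's lemma and primes below a locally principal maximal ideal\<close>

context cring
begin

lemma Idl_insert_subset:
  assumes "insert a B \<subseteq> carrier R" shows "Idl (insert a B) \<subseteq> PIdl a <+> Idl B"
proof (rule genideal_minimal)
  have i: "ideal (PIdl a) R" "ideal (Idl B) R"
    using assms by (auto intro: cgenideal_ideal genideal_ideal)
  then show "ideal (PIdl a <+> Idl B) R" by (rule add_ideals)
  show "insert a B \<subseteq> PIdl a <+> Idl B"
    using subset_set_add[OF i] cgenideal_self[of a] genideal_self[of B] assms by blast
qed

lemma ideal_prod_sum_absorb:
  assumes "ideal K R" "ideal I R" "ideal Q R"
  shows "K \<cdot> (I <+> Q) <+> Q \<subseteq> K \<cdot> I <+> Q"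
proof -
  have KI: "ideal (K \<cdot> I) R" using assms by (simp add: ideal_prod_is_ideal)
  have "K \<cdot> Q \<subseteq> Q" using ideal_prod_inter[OF assms(1,3)] by blast
  then have "K \<cdot> (I <+> Q) \<subseteq> K \<cdot> I <+> Q"
    using ideal_prod_distr(1)[OF assms] set_add_mono[OF subset_refl] by metis
  then show ?thesis
    using subset_set_add(2)[OF KI assms(3)] by (intro set_add_least add_ideals KI assms)
qed

text \<open>The usual statement is the case \<open>K = 0\<close>. The proof removes the generators one at a time: if \<open>N\<close> is
locally contained in \<open>(a) + C\<close>, then feeding this into the hypothesis gives \<open>v a = m a + c\<close> with
\<open>v \<notin> M\<close>, \<open>m \<in> M\<close> and \<open>c \<in> C\<close>, so \<open>v - m\<close> is a denominator that moves \<open>a\<close> into \<open>C\<close>.\<close>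

lemma nakayama:
  assumes M: "primeideal M R" and K: "ideal K R"
    and A: "finite A" "A \<subseteq> carrier R" and N: "N = Idl A"
    and le: "locally_sub R M N (M \<cdot> N <+> K)"
  shows "locally_sub R M N K"
proof -
  have Mi: "ideal M R" by (rule primeideal.axioms(1)[OF M])
  have Ni: "ideal N R" and AN: "A \<subseteq> N" using N A genideal_ideal genideal_self by auto
  have Nc: "N \<subseteq> carrier R" by (rule ideal_subset_carrier[OF Ni])
  have "locally_sub R M N K" if "finite B" "B \<subseteq> N" "locally_sub R M N (Idl B <+> K)" for B
    using that
  proof (induct B)
    case empty
    have "Idl {} <+> K \<subseteq> K"
      by (intro set_add_least genideal_minimal K) auto
    then show ?case using empty locally_sub_mono by blast
  next
    case (insert a B)
    have Bc: "B \<subseteq> carrier R" and a: "a \<in> N" "a \<in> carrier R" using insert Nc by auto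
    define C where "C = Idl B <+> K"
    have pa: "ideal (PIdl a) R" using a by (simp add: cgenideal_ideal)
    have BK: "ideal (Idl B) R" using Bc by (rule genideal_ideal)
    have Ci: "ideal C R" and KC: "K \<subseteq> C" "Idl B \<subseteq> C"
      unfolding C_def using BK K by (auto intro: add_ideals dest: subset_set_add)
    have Ei: "ideal (PIdl a <+> C) R" using pa Ci by (rule add_ideals)
    have "Idl (insert a B) <+> K \<subseteq> PIdl a <+> C"
    proof (rule set_add_least[OF Ei])
      show "Idl (insert a B) \<subseteq> PIdl a <+> C"
        using Idl_insert_subset[of a B] set_add_mono[OF subset_refl KC(2), of "PIdl a"] Bc a by auto
      show "K \<subseteq> PIdl a <+> C" using KC subset_set_add[OF pa Ci] by blast
    qed
    then have NE: "locally_sub R M N (PIdl a <+> C)"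
      using insert locally_sub_mono by blast
    have "M \<cdot> (PIdl a <+> C) <+> K \<subseteq> M \<cdot> (PIdl a) <+> C"
      using ideal_prod_sum_absorb[OF Mi pa Ci] set_add_mono[OF subset_refl KC(1)] by blast
    moreover have "locally_sub R M (M \<cdot> N <+> K) (M \<cdot> (PIdl a <+> C) <+> K)"
      using NE Mi Ni Ei K by (intro locally_sub_add locally_sub_prod ideal_prod_is_ideal)
    ultimately have "locally_sub R M N (M \<cdot> (PIdl a) <+> C)"
      using locally_sub_trans[OF M le _ Nc] locally_sub_mono by blast
    then obtain v where v: "v \<in> carrier R" "v \<notin> M" "v \<otimes> a \<in> M \<cdot> (PIdl a) <+> C"
      using a unfolding locally_sub_def by blast
    obtain m c where mc: "m \<in> M" "c \<in> C" "v \<otimes> a = m \<otimes> a \<oplus> c"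
      using v(3) by (metis set_addE ideal_prod_PIdlE[OF Mi a(2)])
    have cc: "m \<in> carrier R" "c \<in> carrier R" using mc Mi Ci by (auto intro: ideal.Icarr)
    have va: "(v \<ominus> m) \<otimes> a = c" using minus_mult_eq mc cc v a by blast
    have "v = (v \<ominus> m) \<oplus> m" using v cc by (simp add: a_minus_def a_assoc l_neg)
    then have vm: "v \<ominus> m \<notin> M" using ideal_a_closed[OF Mi _ mc(1)] v by metis
    have "(v \<ominus> m) \<otimes> x \<in> C" if "x \<in> PIdl a <+> C" for x
    proof -
      obtain y d where yd: "y \<in> PIdl a" "d \<in> C" "x = y \<oplus> d" using \<open>x \<in> _\<close> by (rule set_addE)
      obtain r where r: "r \<in> carrier R" "y = r \<otimes> a" using yd(1) by (rule PIdl_memE)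
      have "(v \<ominus> m) \<otimes> x = r \<otimes> ((v \<ominus> m) \<otimes> a) \<oplus> (v \<ominus> m) \<otimes> d"
        using yd r v cc a Ci by (simp add: r_distr m_lcomm ideal.Icarr)
      also have "\<dots> \<in> C"
        unfolding va using Ci mc(2) r yd v cc by (intro ideal_a_closed) (auto intro: ideal.I_l_closed)
      finally show ?thesis .
    qed
    then have "locally_sub R M (PIdl a <+> C) C"
      unfolding locally_sub_def using vm v cc by blast
    then have "locally_sub R M N (Idl B <+> K)"
      using locally_sub_trans[OF M NE _ Nc] C_def by blast
    then show ?case using insert by blast
  qed
  moreover have "locally_sub R M N (N <+> K)"
    using M Ni K Nc by (intro locally_sub_subset subset_set_add ideal_subset_carrier add_ideals)
  ultimately show ?thesis using A(1) AN N by blast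
qed

text \<open>Since \<open>M\<close> is locally generated by \<open>p\<close>, the smaller prime \<open>P\<close> cannot contain \<open>p\<close>. An element of
\<open>P\<close> is locally a multiple \<open>r p\<close>, and primality forces \<open>r \<in> P\<close>.\<close>

lemma smaller_prime_locally_absorbs:
  assumes M: "primeideal M R" and P: "primeideal P R" "P \<subseteq> M" "P \<noteq> M"
    and p: "p \<in> M" "locally_sub R M M (PIdl p)"
  shows "locally_sub R M P (M \<cdot> P)"
proof -
  have Mi: "ideal M R" and Pi: "ideal P R" using M P primeideal.axioms(1) by auto
  have Mc: "M \<subseteq> carrier R" by (rule ideal_subset_carrier[OF Mi])
  obtain u where u: "u \<in> carrier R" "u \<notin> M" "\<And>x. x \<in> M \<Longrightarrow> u \<otimes> x \<in> PIdl p"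
    using p unfolding locally_sub_def by blast
  have pP: "p \<notin> P"
  proof
    assume "p \<in> P"
    then have "locally_sub R M M P"
      using cgenideal_minimal[OF Pi] locally_sub_mono[OF p(2)] by blast
    then show False using locally_sub_prime[OF P(1,2) _ Mc] P by blast
  qed
  have "u \<otimes> x \<in> M \<cdot> P" if x: "x \<in> P" for x
  proof -
    obtain r where r: "r \<in> carrier R" "u \<otimes> x = r \<otimes> p"
      using u(3)[of x] x P(2) by (auto elim: PIdl_memE)
    have "r \<otimes> p \<in> P" using ideal.I_l_closed[OF Pi x u(1)] r by simp
    then have "r \<in> P" using primeideal.I_prime[OF P(1)] r pP p Mc by blast
    then have "p \<otimes> r \<in> M \<cdot> P" using p by (simp add: ideal_prod.prod)
    then show ?thesis using r p Mc by (simp add: m_comm subset_iff)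
  qed
  then show ?thesis unfolding locally_sub_def using u by blast
qed

lemma fin_gen_smaller_prime_locally_zero:
  assumes M: "primeideal M R" and P: "primeideal P R" "P \<subseteq> M" "P \<noteq> M"
    and p: "p \<in> M" "locally_sub R M M (PIdl p)"
    and A: "finite A" "A \<subseteq> carrier R" "P = Idl A"
  shows "locally_sub R M P {\<zero>}"
proof (rule nakayama[OF M zeroideal A])
  have Mi: "ideal M R" and Pi: "ideal P R" using M P primeideal.axioms(1) by auto
  show "locally_sub R M P (M \<cdot> P <+> {\<zero>})"
    using smaller_prime_locally_absorbs[OF M P p]
      subset_set_add(1)[OF ideal_prod_is_ideal[OF Mi Pi] zeroideal] locally_sub_mono by blast
qed

end

section \<open>Consequences of factorization into radical ideals\<close>

lemma (in ring) radical_idealI: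
  assumes "ideal I R" "\<And>x n::nat. x \<in> carrier R \<Longrightarrow> n \<ge> 1 \<Longrightarrow> x [^] n \<in> I \<Longrightarrow> x \<in> I"
  shows "radical_ideal I R"
proof -
  have "x \<in> radical R I" if "x \<in> I" for x
    unfolding radical_def using that ideal.Icarr[OF assms(1) that] by (auto intro!: exI[of _ 1])
  then show ?thesis unfolding radical_ideal_def using assms by (auto simp: radical_def)
qed

lemma (in ring) radical_idealD:
  assumes "radical_ideal I R" "x \<in> carrier R" "n \<ge> 1" "x [^] (n::nat) \<in> I" shows "x \<in> I"
  using assms unfolding radical_ideal_def radical_def by blast

lemma (in cring) primeideal_radical:
  assumes "primeideal P R" shows "radical_ideal P R"
proof (rule radical_idealI)
  fix x and n :: nat
  assume x: "x \<in> carrier R"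
  have "x [^] n \<in> P \<Longrightarrow> x \<in> P"
  proof (induct n)
    case 0
    then show ?case using prime_one_notin[OF assms] by simp
  next
    case (Suc n)
    then show ?case using primeideal.I_prime[OF assms, of "x [^] n" x] x by auto
  qed
  then show "x [^] n \<in> P \<Longrightarrow> x \<in> P" .
qed (rule primeideal.axioms(1)[OF assms])

text \<open>Every radical factor of \<open>I\<close> contains \<open>M \<cdot> M\<close>, hence \<open>M\<close>; so \<open>I\<close> is a power of \<open>M\<close>.\<close>

lemma (in ssp_ring) no_ideal_between_square:
  assumes M: "maximalideal M R" and I: "ideal I R" "M \<cdot> M \<subseteq> I" "I \<subseteq> M"
  shows "I = M \<or> I = M \<cdot> M"
proof -
  have Mi: "ideal M R" by (rule maximalideal.axioms(1)[OF M])
  obtain Js where Js: "\<And>J. J \<in> set Js \<Longrightarrow> radical_ideal J R" "I = ideal_prod_list R Js"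
    using ideal_radical_factorization[OF I(1)] by blast
  have Ji: "\<forall>J\<in>set Js. ideal J R" using Js(1) by (simp add: radical_ideal_def)
  have Jcases: "J = M \<or> J = carrier R" if J: "J \<in> set Js" for J
  proof -
    have IJ: "I \<subseteq> J" using ideal_prod_list_subset[OF Ji J] Js by simp
    have "M \<subseteq> J"
    proof
      fix x assume x: "x \<in> M"
      then have xc: "x \<in> carrier R" by (rule ideal.Icarr[OF Mi])
      have "x \<otimes> x \<in> J" using x I IJ ideal_prod.prod[of x M x M R] by blast
      then have "x [^] (2::nat) \<in> J" using xc by (simp add: numeral_2_eq_2)
      then show "x \<in> J" using radical_idealD[OF Js(1)[OF J] xc, of 2] by simp
    qed
    then show ?thesis
      using maximalideal.I_maximal[OF M, of J] Ji J ideal_subset_carrier by blast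
  qed
  have "ideal_prod_list R Js = carrier R \<or> ideal_prod_list R Js = M \<or> ideal_prod_list R Js \<subseteq> M \<cdot> M"
    using Jcases Ji
  proof (induct Js)
    case (Cons J Js)
    let ?L = "ideal_prod_list R Js"
    have L: "ideal ?L R" using Cons by (simp add: ideal_prod_list_ideal)
    have IH: "?L = carrier R \<or> ?L = M \<or> ?L \<subseteq> M \<cdot> M" using Cons by simp
    consider "J = M" | "J = carrier R" using Cons.prems by auto
    then show ?case
    proof cases
      case 1
      have "M \<cdot> (M \<cdot> M) \<subseteq> M \<cdot> M"
        using ideal_prod_inter[OF Mi ideal_prod_is_ideal[OF Mi Mi]] by blast
      then show ?thesis
        using 1 IH ideal_prod_one[OF Mi] ideal_prod_mono[of M M ?L "M \<cdot> M"] by auto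
    next
      case 2
      then show ?thesis using IH ideal_prod_commute[OF oneideal L] ideal_prod_one[OF L] by simp
    qed
  qed simp
  then show ?thesis
    using Js(2) I maximalideal.I_notcarr[OF M] ideal_subset_carrier[OF Mi] by blast
qed

lemma (in ssp_ring) maximal_square_plus_element:
  assumes M: "maximalideal M R" and p: "p \<in> M" "p \<notin> M \<cdot> M"
  shows "M \<cdot> M <+> PIdl p = M"
proof -
  have Mi: "ideal M R" by (rule maximalideal.axioms(1)[OF M])
  have i: "ideal (M \<cdot> M) R" "ideal (PIdl p) R"
    using Mi p by (auto intro: ideal_prod_is_ideal cgenideal_ideal ideal.Icarr)
  have "M \<cdot> M <+> PIdl p \<subseteq> M"
    using ideal_prod_inter[OF Mi Mi] cgenideal_minimal[OF Mi p(1)] by (intro set_add_least Mi) auto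
  moreover have "p \<in> M \<cdot> M <+> PIdl p"
    using subset_set_add(2)[OF i] cgenideal_self ideal.Icarr[OF Mi p(1)] by blast
  ultimately show ?thesis
    using no_ideal_between_square[OF M add_ideals[OF i]] subset_set_add[OF i] p by blast
qed

section \<open>Noetherian SSP-rings are ZPI-rings\<close>

text \<open>Noetherian induction, in the form of a maximum principle for sets of ideals.\<close>

lemma (in noetherian_ring) exists_maximal_member:
  assumes "\<A> \<noteq> {}" "\<And>I. I \<in> \<A> \<Longrightarrow> ideal I R"
  obtains I where "I \<in> \<A>" "\<And>J. J \<in> \<A> \<Longrightarrow> I \<subseteq> J \<Longrightarrow> J = I"
proof -
  have "\<exists>I\<in>\<A>. \<forall>J\<in>\<A>. I \<subseteq> J \<longrightarrow> J = I"
  proof (rule subset_Zorn_nonempty[OF assms(1)])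
    fix C assume C: "C \<noteq> {}" "subset.chain \<A> C"
    then have sub: "C \<subseteq> \<A>" by (simp add: pred_on.chain_def)
    then have "C \<subseteq> {I. ideal I R}" using assms(2) by auto
    then have "subset.chain {I. ideal I R} C"
      using C(2) by (simp add: pred_on.chain_def)
    then show "\<Union>C \<in> \<A>"
      using ideal_chain_is_trivial[OF C(1)] sub by auto
  qed
  then show thesis using that by blast
qed

lemma (in cring) ideal_colon_set:
  assumes "ideal I R" "S \<subseteq> carrier R"
  shows "ideal {x \<in> carrier R. \<forall>s\<in>S. s \<otimes> x \<in> I} R"
proof -
  have "ideal (\<Inter> (insert (carrier R) ((\<lambda>s. {x \<in> carrier R. s \<otimes> x \<in> I}) ` S))) R"
    using oneideal ideal_colon[OF assms(1)] assms(2) by (intro i_Intersect) auto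
  also have "\<Inter> (insert (carrier R) ((\<lambda>s. {x \<in> carrier R. s \<otimes> x \<in> I}) ` S)) =
      {x \<in> carrier R. \<forall>s\<in>S. s \<otimes> x \<in> I}" by auto
  finally show ?thesis .
qed

lemma (in cring) radical_colon:
  assumes I: "radical_ideal I R" and S: "S \<subseteq> carrier R"
  shows "radical_ideal {x \<in> carrier R. \<forall>s\<in>S. s \<otimes> x \<in> I} R"
proof (rule radical_idealI)
  have Ii: "ideal I R" using I by (simp add: radical_ideal_def)
  show "ideal {x \<in> carrier R. \<forall>s\<in>S. s \<otimes> x \<in> I} R" by (rule ideal_colon_set[OF Ii S])
  fix x and n :: nat
  assume x: "x \<in> carrier R" and n: "n \<ge> 1" and xn: "x [^] n \<in> {x \<in> carrier R. \<forall>s\<in>S. s \<otimes> x \<in> I}"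
  have "s \<otimes> x \<in> I" if s: "s \<in> S" for s
  proof -
    have sc: "s \<in> carrier R" using s S by blast
    obtain k where k: "n = Suc k" using n by (cases n) auto
    have "(s \<otimes> x) [^] n = s [^] k \<otimes> (s \<otimes> x [^] n)"
      using sc x by (simp add: k nat_pow_distrib m_ac)
    also have "\<dots> \<in> I" using xn s sc by (blast intro: ideal.I_l_closed[OF Ii] nat_pow_closed)
    finally show ?thesis using radical_idealD[OF I _ n] sc x by simp
  qed
  then show "x \<in> {x \<in> carrier R. \<forall>s\<in>S. s \<otimes> x \<in> I}" using x by simp
qed

text \<open>A maximal counterexample \<open>J\<close> is not prime, say \<open>a b \<in> J\<close> with \<open>a, b \<notin> J\<close>. Both \<open>K = (J : a)\<close> and
\<open>L = (J : K)\<close> are radical and properly larger than \<open>J\<close>, and \<open>K \<inter> L = J\<close> because an element of the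
intersection has its square in \<open>J\<close>.\<close>

lemma (in cring) noetherian_radical_finite_Inter:
  assumes "noetherian_ring R" and I: "radical_ideal I R"
  shows "\<exists>S. finite S \<and> (\<forall>P\<in>S. primeideal P R) \<and> I = carrier R \<inter> \<Inter>S"
proof (rule ccontr)
  define good where "good I \<longleftrightarrow> (\<exists>S. finite S \<and> (\<forall>P\<in>S. primeideal P R) \<and> I = carrier R \<inter> \<Inter>S)" for I
  assume "\<not> ?thesis"
  then have "{I. radical_ideal I R \<and> \<not> good I} \<noteq> {}" using I good_def by auto
  then obtain J where J: "radical_ideal J R" "\<not> good J"
    and max: "\<And>K. radical_ideal K R \<Longrightarrow> \<not> good K \<Longrightarrow> J \<subseteq> K \<Longrightarrow> K = J"
    by (rule noetherian_ring.exists_maximal_member[OF assms(1)]) (auto simp: radical_ideal_def)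
  have Ji: "ideal J R" using J by (simp add: radical_ideal_def)
  note Jc = ideal_subset_carrier[OF Ji]
  have "good J" if "primeideal J R"
    unfolding good_def using that Jc by (intro exI[of _ "{J}"]) auto
  moreover have "good (carrier R)" unfolding good_def by (intro exI[of _ "{}"]) auto
  ultimately obtain a b where ab: "a \<in> carrier R" "b \<in> carrier R" "a \<otimes> b \<in> J" "a \<notin> J" "b \<notin> J"
    using primeidealI[OF Ji is_cring] J(2) by blast
  define K where "K = {x \<in> carrier R. \<forall>s\<in>{a}. s \<otimes> x \<in> J}"
  define L where "L = {x \<in> carrier R. \<forall>s\<in>K. s \<otimes> x \<in> J}"
  have Kc: "K \<subseteq> carrier R" unfolding K_def by auto
  have rad: "radical_ideal K R" "radical_ideal L R"
    unfolding K_def using radical_colon[OF J(1), of "{a}"] ab apply simp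
    unfolding L_def by (rule radical_colon[OF J(1) Kc])
  have JK: "J \<subseteq> K" "J \<subseteq> L"
    unfolding K_def L_def using Jc ab ideal.I_l_closed[OF Ji] by auto
  have "b \<in> K" "a \<in> L" unfolding K_def L_def using ab by (auto simp: m_comm)
  then have "good K" "good L" using max[OF rad(1)] max[OF rad(2)] JK ab by auto
  then obtain S T where ST: "finite S" "\<forall>P\<in>S. primeideal P R" "K = carrier R \<inter> \<Inter>S"
    "finite T" "\<forall>P\<in>T. primeideal P R" "L = carrier R \<inter> \<Inter>T" unfolding good_def by blast
  have "K \<inter> L \<subseteq> J"
  proof
    fix x assume x: "x \<in> K \<inter> L"
    then have "x \<otimes> x \<in> J" "x \<in> carrier R" unfolding L_def by auto
    then show "x \<in> J" using radical_idealD[OF J(1), of x 2] by (simp add: numeral_2_eq_2)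
  qed
  then have "J = K \<inter> L" using JK by blast
  then have "J = carrier R \<inter> \<Inter>(S \<union> T)" using ST by auto
  then have "good J" unfolding good_def using ST by (intro exI[of _ "S \<union> T"]) auto
  then show False using J by blast
qed

lemma (in cring) comaximal_ideal_prod_list:
  "ideal P R \<Longrightarrow> \<forall>Q\<in>set Qs. ideal Q R \<and> P <+> Q = carrier R \<Longrightarrow>
    P <+> ideal_prod_list R Qs = carrier R"
proof (induct Qs)
  case Nil
  have "carrier R \<subseteq> P <+> carrier R" by (rule subset_set_add(2)[OF Nil(1) oneideal])
  moreover have "P <+> carrier R \<subseteq> carrier R"
    by (rule ideal_subset_carrier[OF add_ideals[OF Nil(1) oneideal]])
  ultimately show ?case by simp
next
  case (Cons Q Qs)
  let ?L = "ideal_prod_list R Qs"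
  have i: "ideal P R" "ideal Q R" "ideal ?L R" "ideal (Q \<cdot> ?L) R"
    using Cons ideal_prod_list_ideal[of Qs] by (auto intro: ideal_prod_is_ideal)
  obtain p q where pq: "p \<in> P" "q \<in> Q" "\<one> = p \<oplus> q" using Cons.prems by (auto elim: carrier_eq_sumE)
  have "P <+> ?L = carrier R" using Cons by simp
  then obtain p' l where pl: "p' \<in> P" "l \<in> ?L" "\<one> = p' \<oplus> l" by (rule carrier_eq_sumE)
  have c: "p \<in> carrier R" "q \<in> carrier R" "p' \<in> carrier R" "l \<in> carrier R"
    using pq pl i by (auto intro: ideal.Icarr)
  have "q \<otimes> (p' \<oplus> l) = q" using r_one[OF c(2)] unfolding pl(3) .
  then have "\<one> = p \<oplus> q \<otimes> (p' \<oplus> l)" using pq(3) by metis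
  also have "\<dots> = (p \<oplus> q \<otimes> p') \<oplus> q \<otimes> l" using c by (simp add: r_distr a_assoc)
  also have "\<dots> \<in> P <+> Q \<cdot> ?L"
    using i pq pl c by (intro set_addI ideal_a_closed ideal_prod.prod) (auto intro: ideal.I_l_closed)
  finally show ?case using ideal.one_imp_carrier[OF add_ideals[OF i(1,4)]] by simp
qed

lemma (in cring) Inter_comaximal_eq_prod:
  assumes "finite S" "\<forall>P\<in>S. ideal P R" "\<forall>P\<in>S. \<forall>Q\<in>S. P \<noteq> Q \<longrightarrow> P <+> Q = carrier R"
  shows "\<exists>Ps. set Ps = S \<and> ideal_prod_list R Ps = carrier R \<inter> \<Inter>S"
  using assms
proof (induct S)
  case empty
  then show ?case by simp
next
  case (insert P S)
  then obtain Ps where Ps: "set Ps = S" "ideal_prod_list R Ps = carrier R \<inter> \<Inter>S" by auto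
  have i: "ideal P R" "ideal (ideal_prod_list R Ps) R"
    using insert Ps(1) by (auto intro!: ideal_prod_list_ideal)
  have "P <+> ideal_prod_list R Ps = carrier R"
    using insert Ps by (intro comaximal_ideal_prod_list) auto
  then have "ideal_prod_list R (P # Ps) = P \<inter> ideal_prod_list R Ps"
    using ideal_prod_eq_inter[OF i] by simp
  then have "ideal_prod_list R (P # Ps) = carrier R \<inter> \<Inter> (insert P S)" using Ps by auto
  then show ?case using Ps(1) by (intro exI[of _ "P # Ps"]) simp
qed

locale noetherian_ssp_ring = noetherian_ring + ssp_ring
begin

text \<open>As no ideal lies strictly between \<open>M \<cdot> M\<close> and \<open>M\<close>, at most one generator is needed modulo \<open>M \<cdot> M\<close>,
and Nakayama's lemma lifts it.\<close>

lemma maximal_locally_principal: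
  assumes M: "maximalideal M R"
  obtains p where "p \<in> M" "locally_sub R M M (PIdl p)"
proof -
  have Mp: "primeideal M R" by (rule maximalideal_prime[OF M])
  have Mi: "ideal M R" by (rule maximalideal.axioms(1)[OF M])
  obtain A where A: "finite A" "A \<subseteq> carrier R" "M = Idl A" using finetely_gen[OF Mi] by blast
  have "\<exists>p\<in>M. M \<subseteq> M \<cdot> M <+> PIdl p"
  proof (cases "M \<subseteq> M \<cdot> M")
    case True
    then have "M \<subseteq> M \<cdot> M <+> PIdl \<zero>"
      using subset_set_add(1)[OF ideal_prod_is_ideal[OF Mi Mi] cgenideal_ideal[OF zero_closed]] by blast
    then show ?thesis using ideal_zero_closed[OF Mi] by blast
  next
    case False
    then show ?thesis using maximal_square_plus_element[OF M] by blast
  qed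
  then obtain p where p: "p \<in> M" "M \<subseteq> M \<cdot> M <+> PIdl p" by blast
  have pi: "ideal (PIdl p) R" using p ideal.Icarr[OF Mi] by (simp add: cgenideal_ideal)
  have "locally_sub R M M (M \<cdot> M <+> PIdl p)"
    by (rule locally_sub_subset[OF Mp p(2) ideal_subset_carrier[OF add_ideals[OF ideal_prod_is_ideal[OF Mi Mi] pi]]])
  then show thesis using that[OF p(1) nakayama[OF Mp pi A]] by blast
qed

text \<open>If both primes were in a maximal ideal \<open>M\<close>, each would be properly smaller than \<open>M\<close>, so \<open>P\<close> would
vanish locally at \<open>M\<close> and therefore be contained in \<open>Q\<close>.\<close>

lemma incomparable_primes_comaximal:
  assumes P: "primeideal P R" and Q: "primeideal Q R" and PQ: "\<not> P \<subseteq> Q" "\<not> Q \<subseteq> P"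
  shows "P <+> Q = carrier R"
proof (rule ccontr)
  have Pi: "ideal P R" and Qi: "ideal Q R" using P Q primeideal.axioms(1) by auto
  assume "\<not> ?thesis"
  then obtain M where M: "maximalideal M R" "P <+> Q \<subseteq> M"
    using exists_maximalideal[OF add_ideals[OF Pi Qi]] by metis
  then have sub: "P \<subseteq> M" "Q \<subseteq> M" using subset_set_add[OF Pi Qi] by auto
  have Mp: "primeideal M R" by (rule maximalideal_prime[OF M(1)])
  obtain p where p: "p \<in> M" "locally_sub R M M (PIdl p)" by (rule maximal_locally_principal[OF M(1)])
  obtain A where A: "finite A" "A \<subseteq> carrier R" "P = Idl A" using finetely_gen[OF Pi] by blast
  have "locally_sub R M P {\<zero>}"
    using fin_gen_smaller_prime_locally_zero[OF Mp P sub(1) _ p A] sub PQ by blast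
  then have "locally_sub R M P Q" using ideal_zero_closed[OF Qi] locally_sub_mono by blast
  then show False using locally_sub_prime[OF Q sub(2) _ ideal_subset_carrier[OF Pi]] PQ by blast
qed

text \<open>Only the minimal members of a finite set of primes with intersection \<open>I\<close> matter. They are pairwise
incomparable, hence comaximal, and the intersection of comaximal ideals is their product.\<close>

lemma radical_prime_factorization:
  assumes "radical_ideal I R"
  shows "\<exists>Ps. (\<forall>P\<in>set Ps. primeideal P R) \<and> I = ideal_prod_list R Ps"
proof -
  obtain S where S: "finite S" "\<forall>P\<in>S. primeideal P R" "I = carrier R \<inter> \<Inter>S"
    using noetherian_radical_finite_Inter[OF noetherian_ring_axioms assms] by blast
  define T where "T = {P \<in> S. \<forall>Q\<in>S. Q \<subseteq> P \<longrightarrow> P = Q}"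
  have "\<exists>Q\<in>T. Q \<subseteq> P" if "P \<in> S" for P
    using finite_has_minimal2[OF S(1) that] unfolding T_def by blast
  then have "\<Inter>S = \<Inter>T" unfolding T_def by blast
  moreover have "\<exists>Ps. set Ps = T \<and> ideal_prod_list R Ps = carrier R \<inter> \<Inter>T"
  proof (rule Inter_comaximal_eq_prod)
    show "finite T" using S T_def by auto
    show "\<forall>P\<in>T. ideal P R" using S T_def primeideal.axioms(1) by auto
    show "\<forall>P\<in>T. \<forall>Q\<in>T. P \<noteq> Q \<longrightarrow> P <+> Q = carrier R"
    proof (intro ballI impI)
      fix P Q assume "P \<in> T" "Q \<in> T" "P \<noteq> Q"
      then have "P \<in> S" "Q \<in> S" "\<not> P \<subseteq> Q" "\<not> Q \<subseteq> P" unfolding T_def by auto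
      then show "P <+> Q = carrier R" using S(2) incomparable_primes_comaximal by simp
    qed
  qed
  moreover have "\<forall>P\<in>T. primeideal P R" using S(2) unfolding T_def by simp
  ultimately show ?thesis using S(3) by metis
qed

lemma prime_factorization:
  assumes "ideal I R"
  shows "\<exists>Ps. (\<forall>P\<in>set Ps. primeideal P R) \<and> I = ideal_prod_list R Ps"
proof -
  obtain Js where Js: "\<forall>J\<in>set Js. radical_ideal J R" "I = ideal_prod_list R Js"
    using ideal_radical_factorization[OF assms] by blast
  have "\<exists>Ps. (\<forall>P\<in>set Ps. primeideal P R) \<and> ideal_prod_list R Js = ideal_prod_list R Ps"
    using Js(1)
  proof (induct Js)
    case Nil
    show ?case by (intro exI[of _ "[]"]) simp
  next
    case (Cons J Js)
    then obtain Ps Qs where "\<forall>P\<in>set Ps. primeideal P R" "ideal_prod_list R Js = ideal_prod_list R Ps"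
      "\<forall>P\<in>set Qs. primeideal P R" "J = ideal_prod_list R Qs"
      using radical_prime_factorization[of J] by auto
    note Ps = this
    then have "\<forall>I\<in>set Qs \<union> set Ps. ideal I R" by (auto intro: primeideal.axioms(1))
    from ideal_prod_list_append[OF this] Ps show ?case
      by (intro exI[of _ "Qs @ Ps"]) auto
  qed
  then show ?thesis using Js(2) by simp
qed

end

section \<open>Products of lists after localization\<close>

context cring
begin

lemma set_add_zero: "ideal I R \<Longrightarrow> I <+> {\<zero>} = I"
  using set_add_least[of I I "{\<zero>}"] subset_set_add(1)[OF _ zeroideal, of I] ideal_zero_closed[of I]
  by auto

lemma locally_sub_mult_not_subset:
  assumes "ideal L R" "\<not> L \<subseteq> M" shows "locally_sub R M N (L \<cdot> N)"
  using assms ideal.Icarr[OF assms(1)] ideal_prod.prod[of _ L _ N R]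
  unfolding locally_sub_def by blast

text \<open>This generalizes the fact that \<open>N = L \<cdot> N\<close> for each factor \<open>L\<close> implies \<open>N = L\<^sub>1 \<cdot> \<dots> \<cdot> L\<^sub>n \<cdot> N\<close>.
It is applied to a list of primes with a known product: if each factor locally absorbs \<open>N\<close>,
then \<open>N\<close> is locally contained in that product, modulo \<open>K\<close>.\<close>

lemma locally_sub_prod_list:
  assumes M: "primeideal M R" and N: "ideal N R" and K: "ideal K R"
    and "\<forall>L\<in>set Ls. ideal L R \<and> locally_sub R M N (L \<cdot> N <+> K)"
  shows "locally_sub R M N (ideal_prod_list R Ls \<cdot> N <+> K)"
  using assms(4)
proof (induct Ls)
  case Nil
  have "N \<subseteq> carrier R \<cdot> N <+> K"
    using ideal_prod_commute[OF oneideal N] ideal_prod_one[OF N] subset_set_add(1)[OF N K] by simp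
  then show ?case
    using locally_sub_subset[OF M] ideal_subset_carrier[OF add_ideals[OF ideal_prod_is_ideal[OF oneideal N] K]]
    by simp
next
  case (Cons L Ls)
  let ?B = "ideal_prod_list R Ls"
  have i: "ideal L R" "ideal ?B R" "ideal (?B \<cdot> N) R" "ideal (?B \<cdot> N <+> K) R"
    using Cons.prems ideal_prod_list_ideal[of Ls] N K by (auto intro: ideal_prod_is_ideal add_ideals)
  have "locally_sub R M (L \<cdot> N <+> K) (L \<cdot> (?B \<cdot> N <+> K) <+> K)"
    using Cons i N K by (intro locally_sub_add locally_sub_prod ideal_prod_is_ideal) auto
  then have "locally_sub R M (L \<cdot> N <+> K) (L \<cdot> (?B \<cdot> N) <+> K)"
    using ideal_prod_sum_absorb[OF i(1,3) K] locally_sub_mono by blast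
  then show ?case
    using Cons.prems locally_sub_trans[OF M _ _ ideal_subset_carrier[OF N]]
      ideal_prod_assoc[OF i(1,2) N] by auto
qed

end

section \<open>ZPI-rings: the maximal ideals\<close>

context zpi_ring
begin

lemma prime_factorizationE:
  assumes "ideal I R"
  obtains Ps where "\<forall>P\<in>set Ps. primeideal P R" "\<forall>P\<in>set Ps. ideal P R" "I = ideal_prod_list R Ps"
proof -
  have "\<exists>Ps. (\<forall>P\<in>set Ps. primeideal P R) \<and> I = ideal_prod_list R Ps"
    using ideal_prime_factorization[OF assms] by (cases "I = carrier R") (auto intro!: exI[of _ "[]"])
  then show thesis using that primeideal.axioms(1) by metis
qed

sublocale ssp_ring R
  by unfold_locales (metis prime_factorizationE primeideal_radical)

text \<open>Suppose that the maximal ideal of the local domain \<open>(R/Q)\<^sub>M\<close> is nonzero and idempotent. The claim is that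
this domain contains a prime, other than the maximal ideal, which is nonzero and principal with generator \<open>z\<close>.

Factor \<open>(y) + Q\<close> for some \<open>y \<in> M - Q\<close>. If all prime factors inside \<open>M\<close> were equal to \<open>M\<close>,
then \<open>M\<close> would be locally generated by \<open>y\<close> modulo \<open>Q\<close>, hence not idempotent. So there is a smaller
factor \<open>P\<close>. Over the domain it divides a nonzero principal ideal, hence is invertible, hence locally
principal, and any \<open>z \<in> P\<close> outside \<open>P \<cdot> M + Q\<close> generates it.\<close>

lemma idempotent_modulo_prime_step:
  assumes M: "maximalideal M R" and Q: "primeideal Q R" "Q \<subseteq> M" "Q \<noteq> M"
    and dense: "M \<subseteq> M \<cdot> M <+> Q"
  obtains P z where "primeideal P R" "Q \<subseteq> P" "P \<subseteq> M" "P \<noteq> M"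
    "z \<in> P" "z \<notin> P \<cdot> M <+> Q" "locally_sub R M P (PIdl z <+> Q)"
proof -
  have Mp: "primeideal M R" by (rule maximalideal_prime[OF M])
  have Mi: "ideal M R" and Qi: "ideal Q R" using Mp Q primeideal.axioms(1) by auto
  have MQ: "M <+> Q \<subseteq> M" using Q by (intro set_add_least Mi) auto
  obtain y where y: "y \<in> M" "y \<notin> Q" using Q by blast
  have yc: "y \<in> carrier R" using y Mi by (simp add: ideal.Icarr)
  define Y where "Y = PIdl y <+> Q"
  have yi: "ideal (PIdl y) R" using yc by (rule cgenideal_ideal)
  have Yi: "ideal Y R" and yY: "y \<in> Y" and QY: "Q \<subseteq> Y"
    unfolding Y_def using yi Qi subset_set_add[OF yi Qi] cgenideal_self[OF yc] by (auto intro: add_ideals)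
  have absorb: "K \<cdot> Y <+> Q \<subseteq> K \<cdot> (PIdl y) <+> Q" if "ideal K R" for K
    unfolding Y_def by (rule ideal_prod_sum_absorb[OF that yi Qi])
  obtain Ps where Ps: "\<forall>P\<in>set Ps. primeideal P R" "\<forall>P\<in>set Ps. ideal P R" "Y = ideal_prod_list R Ps"
    by (rule prime_factorizationE[OF Yi])
  have "\<exists>P\<in>set Ps. P \<subseteq> M \<and> P \<noteq> M"
  proof (rule ccontr)
    assume contr: "\<not> ?thesis"
    have "ideal L R \<and> locally_sub R M M (L \<cdot> M <+> Q)" if L: "L \<in> set Ps" for L
    proof -
      have Li: "ideal L R" using Ps L by blast
      have LM: "ideal (L \<cdot> M) R" by (rule ideal_prod_is_ideal[OF Li Mi])
      have "L = M \<or> \<not> L \<subseteq> M" using contr L by blast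
      moreover have ?thesis if "L = M"
        using locally_sub_subset[OF Mp _ ideal_subset_carrier[OF add_ideals[OF LM Qi]]] Li dense that by simp
      moreover have ?thesis if "\<not> L \<subseteq> M"
        using locally_sub_mult_not_subset[OF Li that] subset_set_add(1)[OF LM Qi] Li locally_sub_mono by blast
      ultimately show ?thesis by blast
    qed
    then have "locally_sub R M M (Y \<cdot> M <+> Q)"
      using locally_sub_prod_list[OF Mp Mi Qi] Ps by blast
    then have "locally_sub R M M (M \<cdot> (PIdl y) <+> Q)"
      using absorb[OF Mi] ideal_prod_commute[OF Yi Mi] locally_sub_mono by auto
    then obtain u where "u \<in> carrier R" "u \<notin> M" "u \<otimes> y \<in> M \<cdot> (PIdl y) <+> Q"
      using y unfolding locally_sub_def by blast
    then show False using cancel_modulo_prime[OF Q(1) Mi yc y(2)] MQ by blast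
  qed
  then obtain P where P: "P \<in> set Ps" "P \<subseteq> M" "P \<noteq> M" by blast
  define B where "B = ideal_prod_list R (remove1 P Ps)"
  have Pp: "primeideal P R" and Pi: "ideal P R" using P Ps by auto
  have Bi: "ideal B R" unfolding B_def using Ps(2) by (auto intro!: ideal_prod_list_ideal dest: notin_set_remove1)
  have YPB: "Y = P \<cdot> B" unfolding B_def Ps(3) by (rule ideal_prod_list_remove1[OF Ps(2) P(1)])
  have YP: "Y \<subseteq> P" using ideal_prod_inter[OF Pi Bi] YPB by blast
  \<comment> \<open>Otherwise multiplying by the cofactor \<open>B\<close> gives \<open>(y) = M \<cdot> (y)\<close> modulo \<open>Q\<close>.\<close>
  have "\<not> P \<subseteq> P \<cdot> M <+> Q"
  proof
    assume "P \<subseteq> P \<cdot> M <+> Q"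
    then have "Y \<subseteq> (P \<cdot> M <+> Q) \<cdot> B"
      unfolding YPB by (rule ideal_prod_mono) simp
    also have "\<dots> = (P \<cdot> M) \<cdot> B <+> Q \<cdot> B"
      using Pi Mi Qi Bi by (simp add: ideal_prod_distr ideal_prod_is_ideal)
    also have "(P \<cdot> M) \<cdot> B = M \<cdot> Y"
      unfolding YPB using Pi Mi Bi by (metis ideal_prod_assoc ideal_prod_commute)
    also have "M \<cdot> Y <+> Q \<cdot> B \<subseteq> M \<cdot> Y <+> Q"
      using ideal_prod_inter[OF Qi Bi] by (intro set_add_mono) auto
    finally have "\<one> \<otimes> y \<in> M \<cdot> (PIdl y) <+> Q" using yY absorb[OF Mi] yc by auto
    then have "\<one> \<in> M" using cancel_modulo_prime[OF Q(1) Mi yc y(2) one_closed] MQ by blast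
    then show False using prime_one_notin[OF Mp] by blast
  qed
  then obtain z where z: "z \<in> P" "z \<notin> P \<cdot> M <+> Q" by blast
  have zc: "z \<in> carrier R" using z Pi by (simp add: ideal.Icarr)
  have zi: "ideal (PIdl z) R" using zc by (rule cgenideal_ideal)
  define Z where "Z = B \<cdot> (PIdl z) <+> Q"
  have BZi: "ideal (B \<cdot> (PIdl z)) R" using Bi zi by (rule ideal_prod_is_ideal)
  have Zi: "ideal Z R" unfolding Z_def using BZi Qi by (rule add_ideals)
  have QZ: "Q \<subseteq> Z" and BzZ: "B \<cdot> (PIdl z) \<subseteq> Z" unfolding Z_def using subset_set_add[OF BZi Qi] by auto
  \<comment> \<open>Modulo \<open>Q\<close> this \<open>F\<close> is the quotient of \<open>z B\<close> by \<open>y\<close>, that is \<open>z\<close> times the inverse of \<open>P\<close>. It is locally the unit ideal, for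
      otherwise \<open>z y \<in> z P B\<close> and \<open>z B = y F\<close> would give \<open>z \<in> P F \<subseteq> P M\<close>.\<close>
  define F where "F = {f \<in> carrier R. y \<otimes> f \<in> Z}"
  have Fi: "ideal F R" unfolding F_def using Zi yc by (rule ideal_colon)
  have "\<not> F \<subseteq> M"
  proof
    assume FM: "F \<subseteq> M"
    have PF: "ideal (P \<cdot> F) R" by (rule ideal_prod_is_ideal[OF Pi Fi])
    have PFy: "ideal ((P \<cdot> F) \<cdot> (PIdl y)) R" by (rule ideal_prod_is_ideal[OF PF yi])
    have "z \<otimes> y \<in> (P \<cdot> F) \<cdot> (PIdl y) <+> Q"
    proof (rule mult_ideal_prod_in[OF add_ideals[OF PFy Qi] Pi Bi zc])
      show "y \<in> P \<cdot> B" using yY YPB by simp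
      fix p b assume p: "p \<in> P" and b: "b \<in> B"
      have pb: "p \<in> carrier R" "b \<in> carrier R" using p b Pi Bi by (auto intro: ideal.Icarr)
      have "z \<otimes> b \<in> Y" using z b YPB by (simp add: ideal_prod.prod)
      then obtain t q where tq: "t \<in> PIdl y" "q \<in> Q" "z \<otimes> b = t \<oplus> q" unfolding Y_def by (rule set_addE)
      obtain r where r: "r \<in> carrier R" "t = r \<otimes> y" using tq(1) by (rule PIdl_memE)
      have qc: "q \<in> carrier R" using tq Qi by (simp add: ideal.Icarr)
      have "r \<otimes> y = z \<otimes> b \<ominus> q"
        using tq r qc yc by (simp add: a_minus_def a_assoc r_neg)
      moreover have "z \<otimes> b \<in> Z"
        using ideal_prod.prod[OF b cgenideal_self[OF zc], of R] BzZ m_comm[OF zc pb(2)] by auto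
      ultimately have "r \<otimes> y \<in> Z"
        using ideal_minus_closed[OF Zi, of "z \<otimes> b" q] tq(2) QZ by auto
      then have "r \<in> F" unfolding F_def using r yc by (simp add: m_comm)
      then have "(p \<otimes> r) \<otimes> y \<in> (P \<cdot> F) \<cdot> (PIdl y)"
        using p cgenideal_self[OF yc] by (intro ideal_prod.prod)
      moreover have "p \<otimes> q \<in> Q" using tq pb ideal.I_l_closed[OF Qi] by simp
      moreover have "z \<otimes> (p \<otimes> b) = (p \<otimes> r) \<otimes> y \<oplus> p \<otimes> q"
      proof -
        have "z \<otimes> (p \<otimes> b) = p \<otimes> (z \<otimes> b)" using pb zc by (simp add: m_lcomm)
        also have "\<dots> = (p \<otimes> r) \<otimes> y \<oplus> p \<otimes> q"
          unfolding tq(3) using r pb qc yc by (simp add: r_distr m_assoc)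
        finally show ?thesis .
      qed
      ultimately show "z \<otimes> (p \<otimes> b) \<in> (P \<cdot> F) \<cdot> (PIdl y) <+> Q" using set_addI by simp
    qed
    then have "z \<in> P \<cdot> F <+> Q" by (rule cancel_modulo_prime[OF Q(1) PF yc y(2) zc])
    then show False using z(2) FM set_add_mono[OF ideal_prod_mono[OF subset_refl FM] subset_refl] by blast
  qed
  then obtain f where f: "f \<in> carrier R" "y \<otimes> f \<in> Z" "f \<notin> M" unfolding F_def by blast
  obtain t q where tq: "t \<in> B \<cdot> (PIdl z)" "q \<in> Q" "y \<otimes> f = t \<oplus> q"
    using f(2) unfolding Z_def by (rule set_addE)
  obtain b where b: "b \<in> B" "t = b \<otimes> z" using tq(1) by (rule ideal_prod_PIdlE[OF Bi zc])
  have c: "b \<in> carrier R" "q \<in> carrier R" using b tq Bi Qi by (auto intro: ideal.Icarr)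
  have "f \<otimes> p \<in> PIdl z <+> Q" if p: "p \<in> P" for p
  proof (rule cancel_modulo_prime[OF Q(1) zi yc y(2)])
    have pc: "p \<in> carrier R" using p Pi by (simp add: ideal.Icarr)
    show "f \<otimes> p \<in> carrier R" using f pc by simp
    have "p \<otimes> b \<in> Y" using p b YPB by (simp add: ideal_prod.prod)
    then have "z \<otimes> (p \<otimes> b) \<in> (PIdl z) \<cdot> Y" by (intro ideal_prod.prod cgenideal_self zc)
    moreover have "p \<otimes> q \<in> Q" using tq pc ideal.I_l_closed[OF Qi] by simp
    ultimately have "z \<otimes> (p \<otimes> b) \<oplus> p \<otimes> q \<in> (PIdl z) \<cdot> (PIdl y) <+> Q"
      using absorb[OF zi] set_addI by blast
    also have "z \<otimes> (p \<otimes> b) \<oplus> p \<otimes> q = p \<otimes> (y \<otimes> f)"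
      unfolding tq(3) b(2) using pc c zc by (simp add: r_distr m_ac)
    also have "\<dots> = (f \<otimes> p) \<otimes> y" using pc yc f by (simp add: m_ac)
    finally show "(f \<otimes> p) \<otimes> y \<in> (PIdl z) \<cdot> (PIdl y) <+> Q" .
  qed
  then have "locally_sub R M P (PIdl z <+> Q)" unfolding locally_sub_def using f by blast
  then show thesis using that Pp QY YP P z by blast
qed

text \<open>Applying the preceding lemma twice gives primes \<open>Q \<subset> P \<subset> P' \<subset> M\<close> with \<open>P = (z)\<close> modulo \<open>Q\<close> and
\<open>P' = (w)\<close> modulo \<open>P\<close>, locally. The ideal \<open>I = (w, z\<^sup>2) + Q\<close> has a prime factor \<open>G\<close> contained in \<open>P'\<close>,
and \<open>G\<close> contains \<open>z\<close>, hence \<open>P\<close>, hence \<open>P'\<close>. The cofactor of \<open>G = P'\<close> is not inside \<open>M\<close>, as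
\<open>w\<close> is not in \<open>P' \<cdot> M\<close>. So locally \<open>z \<in> (w, z\<^sup>2) + Q\<close>, say \<open>z = \<alpha> w + \<beta> z\<^sup>2\<close> modulo \<open>Q\<close>; here
\<open>\<alpha> \<in> P\<close> is a multiple of \<open>z\<close>, and cancelling \<open>z\<close> yields \<open>1 \<in> M\<close>.\<close>

lemma not_idempotent_modulo_prime:
  assumes M: "maximalideal M R" and Q: "primeideal Q R" "Q \<subseteq> M" "Q \<noteq> M"
  shows "\<not> M \<subseteq> M \<cdot> M <+> Q"
proof
  assume dense: "M \<subseteq> M \<cdot> M <+> Q"
  have Mp: "primeideal M R" by (rule maximalideal_prime[OF M])
  have Mi: "ideal M R" and Qi: "ideal Q R" using Mp Q primeideal.axioms(1) by auto
  have MQ: "M <+> Q \<subseteq> M" using Q by (intro set_add_least Mi) auto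
  obtain P z where P: "primeideal P R" "Q \<subseteq> P" "P \<subseteq> M" "P \<noteq> M"
    and z: "z \<in> P" "z \<notin> P \<cdot> M <+> Q" and Pz: "locally_sub R M P (PIdl z <+> Q)"
    using idempotent_modulo_prime_step[OF M Q dense] .
  have "M \<subseteq> M \<cdot> M <+> P" using dense set_add_mono[OF subset_refl P(2)] by blast
  then obtain P' w where P': "primeideal P' R" "P \<subseteq> P'" "P' \<subseteq> M"
    and w: "w \<in> P'" "w \<notin> P' \<cdot> M <+> P" and Pw: "locally_sub R M P' (PIdl w <+> P)"
    using idempotent_modulo_prime_step[OF M P(1,3,4)] by metis
  have Pi: "ideal P R" "ideal P' R" using P(1) P'(1) by (auto intro: primeideal.axioms(1))
  have zc: "z \<in> carrier R" and wc: "w \<in> carrier R" using z w Pi by (auto intro: ideal.Icarr)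
  \<comment> \<open>\<open>z \<notin> Q\<close> makes \<open>z\<close> cancellable modulo \<open>Q\<close>, and \<open>w \<notin> P\<close> makes the coefficient of \<open>w\<close> lie in \<open>P\<close>.\<close>
  have zQ: "z \<notin> Q" and wP: "w \<notin> P"
    using z w subset_set_add(2) ideal_prod_is_ideal Pi Mi Qi by blast+
  define I where "I = PIdl w <+> (PIdl (z \<otimes> z) <+> Q)"
  have zi: "ideal (PIdl z) R" and wi: "ideal (PIdl w) R" and zzi: "ideal (PIdl (z \<otimes> z)) R"
    using zc wc by (auto intro: cgenideal_ideal)
  have zzQ: "ideal (PIdl (z \<otimes> z) <+> Q) R" using zzi Qi by (rule add_ideals)
  have Ii: "ideal I R" unfolding I_def using wi zzQ by (rule add_ideals)
  have inI: "w \<in> I" "z \<otimes> z \<in> I" "Q \<subseteq> I"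
    unfolding I_def using subset_set_add[OF wi zzQ] subset_set_add[OF zzi Qi]
      cgenideal_self[OF wc] cgenideal_self[of "z \<otimes> z"] zc by auto
  have "z \<otimes> z \<in> P'" using z P' zc ideal.I_l_closed[OF Pi(2)] by blast
  then have IP': "I \<subseteq> P'"
    unfolding I_def using w P P' cgenideal_minimal[OF Pi(2)] by (intro set_add_least Pi) auto
  obtain Gs where Gs: "\<forall>G\<in>set Gs. primeideal G R" "\<forall>G\<in>set Gs. ideal G R" "I = ideal_prod_list R Gs"
    by (rule prime_factorizationE[OF Ii])
  obtain G where G: "G \<in> set Gs" "G \<subseteq> P'"
    using prime_contains_factor[OF P'(1) Gs(2)] IP' Gs(3) by blast
  have Gp: "primeideal G R" and Gi: "ideal G R" using G Gs by auto
  have IG: "I \<subseteq> G" using ideal_prod_list_subset[OF Gs(2) G(1)] Gs(3) by simp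
  have "z \<in> G" using primeideal.I_prime[OF Gp zc zc] IG inI by blast
  then have "PIdl z <+> Q \<subseteq> G"
    using cgenideal_minimal[OF Gi] IG inI by (intro set_add_least Gi) auto
  then have "locally_sub R M P G" using Pz locally_sub_mono by blast
  then have "P \<subseteq> G" using locally_sub_prime[OF Gp _ _ ideal_subset_carrier[OF Pi(1)]] G P' by blast
  then have "PIdl w <+> P \<subseteq> G"
    using cgenideal_minimal[OF Gi] IG inI by (intro set_add_least Gi) auto
  then have "locally_sub R M P' G" using Pw locally_sub_mono by blast
  then have "P' \<subseteq> G" using locally_sub_prime[OF Gp _ _ ideal_subset_carrier[OF Pi(2)]] G P' by blast
  then have GP': "G = P'" using G by blast
  define B where "B = ideal_prod_list R (remove1 G Gs)"
  have Bi: "ideal B R" unfolding B_def using Gs(2) by (auto intro!: ideal_prod_list_ideal dest: notin_set_remove1)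
  have IB: "I = P' \<cdot> B"
    unfolding B_def Gs(3) using ideal_prod_list_remove1[OF Gs(2) G(1)] GP' by simp
  \<comment> \<open>So locally \<open>I = P'\<close>, and in particular some \<open>z b\<close> with \<open>b \<notin> M\<close> lies in \<open>I\<close>.\<close>
  have "\<not> B \<subseteq> M"
  proof
    assume "B \<subseteq> M"
    then have "w \<in> P' \<cdot> M" using inI IB ideal_prod_mono by blast
    then show False using w subset_set_add(1)[OF ideal_prod_is_ideal[OF Pi(2) Mi] Pi(1)] by blast
  qed
  then obtain b where b: "b \<in> B" "b \<notin> M" by blast
  have bc: "b \<in> carrier R" using b Bi by (simp add: ideal.Icarr)
  have "z \<otimes> b \<in> I" unfolding IB using z P' b by (intro ideal_prod.prod) auto
  then obtain s t where st: "s \<in> PIdl w" "t \<in> PIdl (z \<otimes> z) <+> Q" "z \<otimes> b = s \<oplus> t"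
    unfolding I_def by (rule set_addE)
  obtain \<alpha> where \<alpha>: "\<alpha> \<in> carrier R" "s = \<alpha> \<otimes> w" using st(1) by (rule PIdl_memE)
  have "z \<otimes> z \<in> P" using z zc ideal.I_l_closed[OF Pi(1)] by blast
  then have "PIdl (z \<otimes> z) <+> Q \<subseteq> P"
    using P cgenideal_minimal[OF Pi(1)] by (intro set_add_least Pi) auto
  then have tP: "t \<in> P" using st by blast
  then have tc: "t \<in> carrier R" using Pi by (simp add: ideal.Icarr)
  have "z \<otimes> b \<in> P" using z bc ideal.I_r_closed[OF Pi(1)] by blast
  then have "z \<otimes> b \<ominus> t \<in> P" using tP ideal_minus_closed[OF Pi(1)] by blast
  moreover have "z \<otimes> b \<ominus> t = \<alpha> \<otimes> w"
    using st(3) \<alpha> tc wc by (simp add: a_minus_def a_assoc r_neg)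
  ultimately have \<alpha>P: "\<alpha> \<in> P" using primeideal.I_prime[OF P(1) \<alpha>(1) wc] wP by auto
  obtain f where f: "f \<in> carrier R" "f \<notin> M" "\<And>x. x \<in> P \<Longrightarrow> f \<otimes> x \<in> PIdl z <+> Q"
    using Pz unfolding locally_sub_def by blast
  \<comment> \<open>The target is \<open>f b z \<in> M \<cdot> (z) + Q\<close>, from which \<open>z\<close> can be cancelled.\<close>
  define T where "T = M \<cdot> (PIdl z) <+> Q"
  have Mzi: "ideal (M \<cdot> (PIdl z)) R" by (rule ideal_prod_is_ideal[OF Mi zi])
  have Ti: "ideal T R" unfolding T_def using Mzi Qi by (rule add_ideals)
  have QT: "Q \<subseteq> T" and MzT: "M \<cdot> (PIdl z) \<subseteq> T" unfolding T_def using subset_set_add[OF Mzi Qi] by auto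
  have zM: "z \<in> M" and wM: "w \<in> M" using z w P P' by auto
  have "w \<otimes> (f \<otimes> \<alpha>) \<in> M \<cdot> (PIdl z <+> Q)"
    using f(3)[OF \<alpha>P] wM by (intro ideal_prod.prod)
  then have T1: "w \<otimes> (f \<otimes> \<alpha>) \<in> T"
    using ideal_prod_sum_absorb[OF Mi zi Qi]
      subset_set_add(1)[OF ideal_prod_is_ideal[OF Mi add_ideals[OF zi Qi]] Qi] unfolding T_def by blast
  have "z \<otimes> z \<in> T" using ideal_prod.prod[OF zM cgenideal_self[OF zc], of R] MzT by blast
  then have "PIdl (z \<otimes> z) <+> Q \<subseteq> T"
    using QT cgenideal_minimal[OF Ti] by (intro set_add_least Ti) auto
  then have T2: "f \<otimes> t \<in> T" using st f ideal.I_l_closed[OF Ti] by blast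
  have "(f \<otimes> b) \<otimes> z = f \<otimes> (z \<otimes> b)" using f bc zc by (simp add: m_ac)
  also have "\<dots> = w \<otimes> (f \<otimes> \<alpha>) \<oplus> f \<otimes> t"
    unfolding st(3) \<alpha>(2) using f \<alpha> wc tc by (simp add: r_distr m_ac)
  also have "\<dots> \<in> T" using T1 T2 by (rule ideal_a_closed[OF Ti])
  finally have "f \<otimes> b \<in> M"
    using cancel_modulo_prime[OF Q(1) Mi zc zQ, of "f \<otimes> b"] f bc MQ unfolding T_def by blast
  then show False using primeideal.I_prime[OF Mp f(1) bc] f b by blast
qed

text \<open>If \<open>M\<close> differs from \<open>M \<cdot> M\<close>, take \<open>p \<in> M - M \<cdot> M\<close>: exactly one prime factor of \<open>(p)\<close> is inside \<open>M\<close>, and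
a factor smaller than \<open>M\<close> would make \<open>M\<close> idempotent modulo it. If \<open>M = M \<cdot> M\<close>, no prime is properly
below \<open>M\<close>, so every factor of \<open>0\<close> inside \<open>M\<close> is \<open>M\<close> itself and \<open>M\<close> vanishes locally; then \<open>p = 0\<close>.\<close>

lemma maximal_divides_principal:
  assumes M: "maximalideal M R"
  obtains p C where "p \<in> M" "ideal C R" "\<not> C \<subseteq> M" "M \<cdot> C \<subseteq> PIdl p"
proof (cases "M \<subseteq> M \<cdot> M")
  case False
  have Mp: "primeideal M R" by (rule maximalideal_prime[OF M])
  have Mi: "ideal M R" by (rule maximalideal.axioms(1)[OF M])
  obtain p where p: "p \<in> M" "p \<notin> M \<cdot> M" using False by blast
  have pc: "p \<in> carrier R" using p Mi by (simp add: ideal.Icarr)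
  obtain Ps where Ps: "\<forall>P\<in>set Ps. primeideal P R" "\<forall>P\<in>set Ps. ideal P R" "PIdl p = ideal_prod_list R Ps"
    by (rule prime_factorizationE[OF cgenideal_ideal[OF pc]])
  obtain P where P: "P \<in> set Ps" "P \<subseteq> M"
    using prime_contains_factor[OF Mp Ps(2)] cgenideal_minimal[OF Mi p(1)] Ps(3) by blast
  define C where "C = ideal_prod_list R (remove1 P Ps)"
  have Ci: "ideal C R" unfolding C_def using Ps(2) by (auto intro!: ideal_prod_list_ideal dest: notin_set_remove1)
  have pPC: "PIdl p = P \<cdot> C" unfolding C_def Ps(3) by (rule ideal_prod_list_remove1[OF Ps(2) P(1)])
  have pP: "PIdl p \<subseteq> P" using ideal_prod_list_subset[OF Ps(2) P(1)] Ps(3) by simp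
  have "M \<subseteq> M \<cdot> M <+> P"
    using maximal_square_plus_element[OF M p] set_add_mono[OF subset_refl pP, of "M \<cdot> M"] by simp
  then have PM: "P = M" using not_idempotent_modulo_prime[OF M] Ps(1) P by blast
  have "\<not> C \<subseteq> M"
    using p(2) cgenideal_self[OF pc] pPC ideal_prod_mono[of M M C M] PM by blast
  then show thesis using that p Ci pPC PM by blast
next
  case True
  have Mp: "primeideal M R" by (rule maximalideal_prime[OF M])
  have Mi: "ideal M R" by (rule maximalideal.axioms(1)[OF M])
  have MM: "ideal (M \<cdot> M) R" by (rule ideal_prod_is_ideal[OF Mi Mi])
  obtain Ps where Ps: "\<forall>P\<in>set Ps. primeideal P R" "\<forall>P\<in>set Ps. ideal P R" "{\<zero>} = ideal_prod_list R Ps"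
    by (rule prime_factorizationE[OF zeroideal])
  have "locally_sub R M M (L \<cdot> M <+> {\<zero>})" if L: "L \<in> set Ps" for L
  proof -
    have Li: "ideal L R" "primeideal L R" using Ps L by auto
    have eq: "L \<cdot> M <+> {\<zero>} = L \<cdot> M" using Li Mi by (simp add: set_add_zero ideal_prod_is_ideal)
    have "\<not> M \<subseteq> M \<cdot> M <+> L" if "L \<subseteq> M" "L \<noteq> M"
      by (rule not_idempotent_modulo_prime[OF M Li(2) that])
    then have "L = M \<or> \<not> L \<subseteq> M" using True subset_set_add(1)[OF MM Li(1)] by blast
    then show ?thesis
      unfolding eq using locally_sub_mult_not_subset[OF Li(1)]
        locally_sub_subset[OF Mp True ideal_subset_carrier[OF MM]] by blast
  qed
  then have "locally_sub R M M ({\<zero>} \<cdot> M <+> {\<zero>})"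
    using locally_sub_prod_list[OF Mp Mi zeroideal] Ps by metis
  moreover have "{\<zero>} \<cdot> M <+> {\<zero>} = {\<zero>}"
    using ideal_prod_commute[OF zeroideal Mi] ideal_prod_zero[OF Mi] set_add_zero[OF zeroideal] by simp
  ultimately obtain u where u: "u \<in> carrier R" "u \<notin> M" "\<And>x. x \<in> M \<Longrightarrow> u \<otimes> x = \<zero>"
    unfolding locally_sub_def by auto
  have "M \<cdot> (PIdl u) \<subseteq> PIdl \<zero>"
  proof
    fix x assume "x \<in> M \<cdot> (PIdl u)"
    then obtain k where "k \<in> M" "x = k \<otimes> u" by (rule ideal_prod_PIdlE[OF Mi u(1)])
    then have "x = \<zero>" using u ideal.Icarr[OF Mi] by (simp add: m_comm)
    then show "x \<in> PIdl \<zero>" using cgenideal_self[OF zero_closed] by simp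
  qed
  then show thesis
    using that[OF ideal_zero_closed[OF Mi] cgenideal_ideal[OF u(1)]] u(2) cgenideal_self[OF u(1)] by blast
qed

end

section \<open>ZPI-rings are Noetherian\<close>

context zpi_ring
begin

lemma maximal_locally_principal:
  assumes M: "maximalideal M R"
  obtains p where "p \<in> M" "locally_sub R M M (PIdl p)"
proof -
  have Mi: "ideal M R" by (rule maximalideal.axioms(1)[OF M])
  obtain p C where p: "p \<in> M" "ideal C R" "\<not> C \<subseteq> M" "M \<cdot> C \<subseteq> PIdl p"
    using maximal_divides_principal[OF M] .
  have "locally_sub R M M (PIdl p)"
    using locally_sub_mult_not_subset[OF p(2,3), of M] p(4) ideal_prod_commute[OF p(2) Mi]
      locally_sub_mono by auto
  then show thesis using that p by blast
qed

text \<open>\<open>(x)\<close> has a prime factor \<open>Q \<subseteq> P\<close>. It satisfies \<open>Q = M \<cdot> Q\<close> locally, hence so does \<open>(x)\<close>, and Nakayama's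
lemma applies to \<open>(x)\<close> although \<open>P\<close> is not yet known to be finitely generated.\<close>

lemma smaller_prime_elements_locally_zero:
  assumes M: "maximalideal M R" and P: "primeideal P R" "P \<subseteq> M" "P \<noteq> M" and x: "x \<in> P"
  shows "locally_sub R M (PIdl x) {\<zero>}"
proof -
  have Mp: "primeideal M R" by (rule maximalideal_prime[OF M])
  have Mi: "ideal M R" and Pi: "ideal P R" using Mp P primeideal.axioms(1) by auto
  have xc: "x \<in> carrier R" using x Pi by (simp add: ideal.Icarr)
  obtain p where p: "p \<in> M" "locally_sub R M M (PIdl p)" by (rule maximal_locally_principal[OF M])
  have xi: "ideal (PIdl x) R" using xc by (rule cgenideal_ideal)
  obtain Ps where Ps: "\<forall>P\<in>set Ps. primeideal P R" "\<forall>P\<in>set Ps. ideal P R" "PIdl x = ideal_prod_list R Ps"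
    by (rule prime_factorizationE[OF xi])
  obtain Q where Q: "Q \<in> set Ps" "Q \<subseteq> P"
    using prime_contains_factor[OF P(1) Ps(2)] cgenideal_minimal[OF Pi x] Ps(3) by blast
  have Qp: "primeideal Q R" and Qi: "ideal Q R" using Q Ps by auto
  define B where "B = ideal_prod_list R (remove1 Q Ps)"
  have Bi: "ideal B R" unfolding B_def using Ps(2) by (auto intro!: ideal_prod_list_ideal dest: notin_set_remove1)
  have xQB: "PIdl x = B \<cdot> Q"
    unfolding B_def Ps(3) using ideal_prod_list_remove1[OF Ps(2) Q(1)] ideal_prod_commute[OF Qi] Bi B_def by simp
  have "locally_sub R M Q (M \<cdot> Q)"
    using smaller_prime_locally_absorbs[OF Mp Qp _ _ p] Q P by blast
  then have "locally_sub R M (B \<cdot> Q) (B \<cdot> (M \<cdot> Q))"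
    by (rule locally_sub_prod[OF _ Bi Qi ideal_prod_is_ideal[OF Mi Qi]])
  also have "B \<cdot> (M \<cdot> Q) = M \<cdot> (B \<cdot> Q)"
    using Bi Mi Qi by (metis ideal_prod_assoc ideal_prod_commute)
  finally have "locally_sub R M (PIdl x) (M \<cdot> (PIdl x) <+> {\<zero>})"
    unfolding xQB[symmetric] using set_add_zero ideal_prod_is_ideal[OF Mi xi] by simp
  then show ?thesis
    using nakayama[OF Mp zeroideal, of "{x}" "PIdl x"] xc cgenideal_eq_genideal by simp
qed

lemma smaller_prime_unique:
  assumes M: "maximalideal M R" and P: "primeideal P R" "P \<subseteq> M" "P \<noteq> M"
    and Q: "primeideal Q R" "Q \<subseteq> M"
  shows "P \<subseteq> Q"
proof
  fix x assume x: "x \<in> P"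
  then have xc: "x \<in> carrier R" using ideal.Icarr[OF primeideal.axioms(1)[OF P(1)]] by blast
  have "locally_sub R M (PIdl x) Q"
    using smaller_prime_elements_locally_zero[OF M P x]
      ideal_zero_closed[OF primeideal.axioms(1)[OF Q(1)]] locally_sub_mono by blast
  then show "x \<in> Q"
    using locally_sub_prime[OF Q] ideal_subset_carrier[OF cgenideal_ideal[OF xc]] cgenideal_self[OF xc]
    by blast
qed

text \<open>All elements of \<open>P\<close> vanish locally; what has to be found is one denominator for all of them. By
uniqueness, a prime inside \<open>M\<close> is \<open>M\<close> or \<open>P\<close>, so every prime \<open>L \<noteq> P\<close> locally absorbs \<open>P\<close>. If \<open>P\<close>
did not vanish uniformly, then for \<open>x \<in> P\<close> the factorization of \<open>(x)\<close> would contain \<open>P\<close> at least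
twice, for otherwise \<open>P\<close> would be locally contained in \<open>(x)\<close>. Thus \<open>P = P \<cdot> P\<close>, now all
prime factors of \<open>0\<close> absorb \<open>P\<close>, and \<open>P\<close> vanishes after all.\<close>

lemma smaller_prime_locally_zero:
  assumes M: "maximalideal M R" and P: "primeideal P R" "P \<subseteq> M" "P \<noteq> M"
  shows "locally_sub R M P {\<zero>}"
proof (rule ccontr)
  assume contr: "\<not> ?thesis"
  have Mp: "primeideal M R" by (rule maximalideal_prime[OF M])
  have Mi: "ideal M R" and Pi: "ideal P R" using Mp P primeideal.axioms(1) by auto
  have Pc: "P \<subseteq> carrier R" using Pi by (rule ideal_subset_carrier)
  have PP: "ideal (P \<cdot> P) R" using Pi by (simp add: ideal_prod_is_ideal)
  obtain p where p: "p \<in> M" "locally_sub R M M (PIdl p)" by (rule maximal_locally_principal[OF M])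
  have absorbs: "locally_sub R M P (M \<cdot> P)" by (rule smaller_prime_locally_absorbs[OF Mp P p])
  have prime_cases: "L = P \<or> locally_sub R M P (L \<cdot> P <+> {\<zero>})" if L: "primeideal L R" for L
  proof -
    have Li: "ideal L R" by (rule primeideal.axioms(1)[OF L])
    have "L = P" if "L \<subseteq> M" "L \<noteq> M"
      using smaller_prime_unique[OF M P L that(1)] smaller_prime_unique[OF M L that P(1,2)] by blast
    then have "L = P \<or> L = M \<or> \<not> L \<subseteq> M" by blast
    then show ?thesis
      using absorbs locally_sub_mult_not_subset[OF Li, of M P]
        set_add_zero[OF ideal_prod_is_ideal[OF Li Pi]] by auto
  qed
  have no_prod: False
    if "\<forall>L\<in>set Ls. ideal L R" "\<forall>L\<in>set Ls. locally_sub R M P (L \<cdot> P <+> {\<zero>})"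
      "locally_sub R M (ideal_prod_list R Ls \<cdot> P) {\<zero>}" for Ls
  proof -
    have "locally_sub R M P (ideal_prod_list R Ls \<cdot> P <+> {\<zero>})"
      using locally_sub_prod_list[OF Mp Pi zeroideal] that by blast
    then show False
      using set_add_zero[OF ideal_prod_is_ideal[OF ideal_prod_list_ideal[OF that(1)] Pi]]
        locally_sub_trans[OF Mp _ that(3) Pc] contr by simp
  qed
  have idem: "P \<subseteq> P \<cdot> P"
  proof
    fix x assume x: "x \<in> P"
    then have xc: "x \<in> carrier R" using Pc by blast
    obtain Ps where Ps: "\<forall>P\<in>set Ps. primeideal P R" "\<forall>P\<in>set Ps. ideal P R" "PIdl x = ideal_prod_list R Ps"
      by (rule prime_factorizationE[OF cgenideal_ideal[OF xc]])
    obtain Q where Q: "Q \<in> set Ps" "Q \<subseteq> P"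
      using prime_contains_factor[OF P(1) Ps(2)] cgenideal_minimal[OF Pi x] Ps(3) by blast
    have "Q = P"
      using smaller_prime_unique[OF M P, of Q] Q P Ps(1) by blast
    then have PPs: "P \<in> set Ps" using Q by simp
    define Ls where "Ls = remove1 P Ps"
    have Ls: "\<forall>L\<in>set Ls. primeideal L R" "\<forall>L\<in>set Ls. ideal L R"
      unfolding Ls_def using Ps by (auto dest: notin_set_remove1)
    have Lsi: "ideal (ideal_prod_list R Ls) R" by (rule ideal_prod_list_ideal[OF Ls(2)])
    have xL: "PIdl x = P \<cdot> ideal_prod_list R Ls"
      unfolding Ls_def Ps(3) by (rule ideal_prod_list_remove1[OF Ps(2) PPs])
    have "P \<in> set Ls"
    proof (rule ccontr)
      assume "P \<notin> set Ls"
      then have "\<forall>L\<in>set Ls. locally_sub R M P (L \<cdot> P <+> {\<zero>})" using prime_cases Ls(1) by blast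
      moreover have "locally_sub R M (ideal_prod_list R Ls \<cdot> P) {\<zero>}"
        using smaller_prime_elements_locally_zero[OF M P x] xL ideal_prod_commute[OF Pi Lsi] by simp
      ultimately show False using no_prod Ls(2) by blast
    qed
    then have "ideal_prod_list R Ls \<subseteq> P" by (rule ideal_prod_list_subset[OF Ls(2)])
    then have "PIdl x \<subseteq> P \<cdot> P" unfolding xL by (rule ideal_prod_mono[OF subset_refl])
    then show "x \<in> P \<cdot> P" using cgenideal_self[OF xc] by blast
  qed
  obtain Ps where Ps: "\<forall>P\<in>set Ps. primeideal P R" "\<forall>P\<in>set Ps. ideal P R" "{\<zero>} = ideal_prod_list R Ps"
    by (rule prime_factorizationE[OF zeroideal])
  have "locally_sub R M P (P \<cdot> P <+> {\<zero>})"
    unfolding set_add_zero[OF PP] using locally_sub_subset[OF Mp idem ideal_subset_carrier[OF PP]] .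
  then have "\<forall>L\<in>set Ps. locally_sub R M P (L \<cdot> P <+> {\<zero>})" using prime_cases Ps(1) by blast
  moreover have "ideal_prod_list R Ps \<cdot> P = {\<zero>}"
    unfolding Ps(3)[symmetric] using ideal_prod_commute[OF zeroideal Pi] ideal_prod_zero[OF Pi] by simp
  then have "locally_sub R M (ideal_prod_list R Ps \<cdot> P) {\<zero>}"
    using locally_sub_subset[OF Mp, of "{\<zero>}" "{\<zero>}"] by simp
  ultimately show False using no_prod[OF Ps(2)] by blast
qed

text \<open>With \<open>M \<cdot> C \<subseteq> (p)\<close> and \<open>1 = m + c\<close> for some \<open>c \<in> C\<close>, each \<open>x \<in> M\<close> is \<open>x m + x c \<in> (m, p)\<close>.\<close>

lemma maximal_fin_gen:
  assumes M: "maximalideal M R"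
  shows "\<exists>A\<subseteq>carrier R. finite A \<and> M = Idl A"
proof -
  have Mi: "ideal M R" by (rule maximalideal.axioms(1)[OF M])
  obtain p C where p: "p \<in> M" "ideal C R" "\<not> C \<subseteq> M" "M \<cdot> C \<subseteq> PIdl p"
    using maximal_divides_principal[OF M] .
  obtain m c where mc: "m \<in> M" "c \<in> C" "\<one> = m \<oplus> c"
    using maximal_sum_eq_carrier[OF M p(2,3)] by (rule carrier_eq_sumE)
  have cc: "p \<in> carrier R" "m \<in> carrier R" "c \<in> carrier R" using p mc Mi by (auto intro: ideal.Icarr)
  let ?G = "Idl {p, m}"
  have Gi: "ideal ?G R" and G: "p \<in> ?G" "m \<in> ?G"
    using cc genideal_ideal[of "{p, m}"] genideal_self[of "{p, m}"] by auto
  have "M \<subseteq> ?G"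
  proof
    fix x assume x: "x \<in> M"
    then have xc: "x \<in> carrier R" using Mi by (simp add: ideal.Icarr)
    have "x = x \<otimes> (m \<oplus> c)" using xc mc(3)[symmetric] by simp
    also have "\<dots> = x \<otimes> m \<oplus> x \<otimes> c" using xc cc by (simp add: r_distr)
    also have "\<dots> \<in> ?G"
    proof (rule ideal_a_closed[OF Gi])
      show "x \<otimes> m \<in> ?G" using G xc by (intro ideal.I_l_closed[OF Gi])
      have "x \<otimes> c \<in> M \<cdot> C" using x mc by (intro ideal_prod.prod)
      then show "x \<otimes> c \<in> ?G" using p(4) cgenideal_minimal[OF Gi G(1)] by blast
    qed
    finally show "x \<in> ?G" .
  qed
  moreover have "?G \<subseteq> M" using p mc by (intro genideal_minimal Mi) auto
  ultimately show ?thesis using cc by (intro exI[of _ "{p, m}"]) auto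
qed

text \<open>Uniform local vanishing says that the annihilator \<open>N\<close> of \<open>P\<close> is contained in no maximal ideal above \<open>P\<close>.
So \<open>P + N\<close> is the unit ideal, and \<open>1 = e + s\<close> with \<open>s\<close> annihilating \<open>P\<close> gives \<open>P = (e)\<close>.\<close>

lemma nonmaximal_prime_fin_gen:
  assumes P: "primeideal P R" and nonmax: "\<not> maximalideal P R"
  shows "\<exists>A\<subseteq>carrier R. finite A \<and> P = Idl A"
proof -
  have Pi: "ideal P R" by (rule primeideal.axioms(1)[OF P])
  have Pc: "P \<subseteq> carrier R" by (rule ideal_subset_carrier[OF Pi])
  define N where "N = {s \<in> carrier R. \<forall>x\<in>P. x \<otimes> s \<in> {\<zero>}}"
  have Ni: "ideal N R" unfolding N_def by (rule ideal_colon_set[OF zeroideal Pc])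
  have "P <+> N = carrier R"
  proof (rule ccontr)
    assume "P <+> N \<noteq> carrier R"
    then obtain M where M: "maximalideal M R" "P <+> N \<subseteq> M"
      by (rule exists_maximalideal[OF add_ideals[OF Pi Ni]])
    then have sub: "P \<subseteq> M" "N \<subseteq> M" using subset_set_add[OF Pi Ni] by auto
    have "locally_sub R M P {\<zero>}"
      using smaller_prime_locally_zero[OF M(1) P sub(1)] M(1) nonmax by blast
    then obtain u where u: "u \<in> carrier R" "u \<notin> M" "\<And>x. x \<in> P \<Longrightarrow> u \<otimes> x = \<zero>"
      unfolding locally_sub_def by blast
    then have "u \<in> N" unfolding N_def using Pc by (auto simp: m_comm subset_iff)
    then show False using u sub by blast
  qed
  then obtain e s where es: "e \<in> P" "s \<in> N" "\<one> = e \<oplus> s" by (rule carrier_eq_sumE)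
  have c: "e \<in> carrier R" "s \<in> carrier R" using es Pc by (auto simp: N_def)
  have "P \<subseteq> PIdl e"
  proof
    fix x assume x: "x \<in> P"
    then have xc: "x \<in> carrier R" using Pc by blast
    have "x = x \<otimes> (e \<oplus> s)" using xc es(3)[symmetric] by simp
    also have "\<dots> = x \<otimes> e" using xc c x es(2) by (simp add: r_distr N_def)
    finally show "x \<in> PIdl e" unfolding cgenideal_def using xc by blast
  qed
  then have "P = Idl {e}"
    using cgenideal_minimal[OF Pi es(1)] cgenideal_eq_genideal[OF c(1)] by simp
  then show ?thesis using c by (intro exI[of _ "{e}"]) auto
qed

lemma prime_fin_gen:
  "primeideal P R \<Longrightarrow> \<exists>A\<subseteq>carrier R. finite A \<and> P = Idl A"
  using maximal_fin_gen nonmaximal_prime_fin_gen by blast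

end

lemma (in cring) ideal_prod_Idl:
  assumes A: "A \<subseteq> carrier R" and B: "B \<subseteq> carrier R"
  shows "(Idl A) \<cdot> (Idl B) = Idl (A <#> B)"
proof
  have i: "ideal (Idl A) R" "ideal (Idl B) R" using A B by (auto intro: genideal_ideal)
  have AB: "A <#> B \<subseteq> carrier R" by (rule set_mult_closed[OF A B])
  have Ki: "ideal (Idl (A <#> B)) R" (is "ideal ?K R") using AB by (rule genideal_ideal)
  have gen: "a \<otimes> b \<in> ?K" if "a \<in> A" "b \<in> B" for a b
    using genideal_self[OF AB] that unfolding set_mult_def by blast
  have step: "a \<otimes> y \<in> ?K" if a: "a \<in> A" and y: "y \<in> Idl B" for a y
  proof -
    have "Idl B \<subseteq> {y \<in> carrier R. a \<otimes> y \<in> ?K}"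
      using a A B gen by (intro genideal_minimal ideal_colon Ki) auto
    then show ?thesis using y by blast
  qed
  show "(Idl A) \<cdot> (Idl B) \<subseteq> ?K"
  proof (rule ideal_prod_least[OF Ki])
    fix x y assume x: "x \<in> Idl A" and y: "y \<in> Idl B"
    have yc: "y \<in> carrier R" using y i by (auto intro: ideal.Icarr)
    have "Idl A \<subseteq> {x \<in> carrier R. y \<otimes> x \<in> ?K}"
      using A yc y step by (intro genideal_minimal ideal_colon Ki) (auto simp: m_comm subset_iff)
    then have "y \<otimes> x \<in> ?K" "x \<in> carrier R" using x by auto
    then show "x \<otimes> y \<in> ?K" using yc by (simp add: m_comm)
  qed
  show "?K \<subseteq> (Idl A) \<cdot> (Idl B)"
    using genideal_self[OF A] genideal_self[OF B]
    by (intro genideal_minimal ideal_prod_is_ideal i) (auto simp: set_mult_def intro!: ideal_prod.prod)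
qed

lemma (in cring) fin_gen_prod_list:
  "\<forall>I\<in>set Is. \<exists>A\<subseteq>carrier R. finite A \<and> I = Idl A \<Longrightarrow>
    \<exists>A\<subseteq>carrier R. finite A \<and> ideal_prod_list R Is = Idl A"
proof (induct Is)
  case Nil
  show ?case using genideal_one by (intro exI[of _ "{\<one>}"]) simp
next
  case (Cons I Is)
  then obtain A B where AB: "A \<subseteq> carrier R" "finite A" "I = Idl A"
    "B \<subseteq> carrier R" "finite B" "ideal_prod_list R Is = Idl B" by auto
  have "A <#> B = (\<Union>a\<in>A. \<Union>b\<in>B. {a \<otimes> b})" unfolding set_mult_def by blast
  then have "finite (A <#> B)" using AB by simp
  then show ?case
    using ideal_prod_Idl[OF AB(1,4)] AB set_mult_closed[OF AB(1,4)] by auto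
qed

lemma (in zpi_ring) noetherian: "noetherian_ring R"
proof (rule noetherian_ringI)
  fix I assume "ideal I R"
  then obtain Ps where "\<forall>P\<in>set Ps. primeideal P R" "I = ideal_prod_list R Ps"
    by (rule prime_factorizationE)
  then show "\<exists>A\<subseteq>carrier R. finite A \<and> I = Idl A"
    using fin_gen_prod_list[of Ps] prime_fin_gen by simp
qed

theorem corollary3p5:
  fixes A :: "('a, 'b) ring_scheme"
  assumes "cring A"
  shows "noetherian_ring A \<and> ssp_ring A \<longleftrightarrow> zpi_ring A"
proof
  assume "noetherian_ring A \<and> ssp_ring A"
  then interpret noetherian_ssp_ring A by (simp add: noetherian_ssp_ring_def)
  show "zpi_ring A" by unfold_locales (rule prime_factorization)
next
  assume "zpi_ring A"
  then interpret zpi_ring A .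
  show "noetherian_ring A \<and> ssp_ring A" using noetherian ssp_ring_axioms by blast
qed

end
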